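(* A Frenet curve $\bar\gamma:I\subset\mathbb{R}\to\mathbb{C}P^n$ parametrized by arc-length with $\bar\tau_{12}=0$ is proper-biharmonic if and only if either (a) $n=2$ and $\bar\gamma$ is a circle with $\bar k_1=1$, or (b) $n\ge3$ and $\bar\gamma$ is a circle with $\bar k_1=1$ or a helix with $\bar k_1^2+\bar k_2^2=1$.
   Context: $\mathbb{C}P^n$ carries the Fubini-Study metric $\langle\cdot,\cdot\rangle$ of constant holomorphic sectional curvature $4$, with complex structure $\bar J$ and Levi-Civita connection $\bar\nabla$. A curve $\bar\gamma:I\subset\mathbb{R}\to\mathbb{C}P^n$ parametrized by arc-length is a Frenet curve of osculating order $d$ ($1\le d\le 2n$) if there exist $d$ orthonormal vector fields $\bar E_1=\bar\gamma',\dots,\bar E_d$ along $\bar\gamma$ such that $\bar\nabla_{\bar E_1}\bar E_1=\bar k_1\bar E_2$, $\bar\nabla_{\bar E_1}\bar E_i=-\bar k_{i-1}\bar E_{i-1}+\bar k_i\bar E_{i+1}$ for $2\le i\le d-1$, $\bar\nabla_{\bar E_1}\bar E_d=-\bar k_{d-1}\bar E_{d-1}$, where $\bar k_1,\dots,\bar k_{d-1}$ are positive functions (the curvatures). It is a helix of order $d$ if all $\bar k_i$ are positive constants; a helix of order $2$ is called a circle, and a helix of order $3$ is simply called a helix. The complex torsions are $\bar\tau_{ij}=\langle\bar E_i,\bar J\bar E_j\rangle$, $1\le i<j\le d$. A map $\varphi:(M,g)\to(N,h)$ is biharmonic if $\tau_2(\varphi)=-\Delta^{\varphi}\tau(\varphi)-\operatorname{trace}R^N(d\varphi,\tau(\varphi))d\varphi=0$,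 where $\tau(\varphi)=\operatorname{trace}\nabla d\varphi$, $\Delta^\varphi=-\operatorname{trace}(\nabla^\varphi)^2$ and $R^N(X,Y)Z=\nabla_X\nabla_YZ-\nabla_Y\nabla_XZ-\nabla_{[X,Y]}Z$; it is proper-biharmonic if moreover it is not harmonic. A curve is proper-biharmonic if it is so as a map from the interval $I$. *)

theory Defs
  imports "HOL-Analysis.Analysis"
begin

section \<open>Smooth maps\<close>

text \<open>
  The sets \<open>S\<close> used below are open sets and nondegenerate intervals of the real line; on these the
  Frechet derivative within \<open>S\<close> is unique.
\<close>

primrec Ck_on :: "nat \<Rightarrow> 'a set \<Rightarrow> ('a::real_normed_vector \<Rightarrow> 'b::real_normed_vector) \<Rightarrow> bool" where
  "Ck_on 0 S f \<longleftrightarrow> continuous_on S f"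
| "Ck_on (Suc k) S f \<longleftrightarrow>
     f differentiable_on S \<and> (\<forall>v. Ck_on k S (\<lambda>x. frechet_derivative f (at x within S) v))"

definition smooth_on :: "'a set \<Rightarrow> ('a::real_normed_vector \<Rightarrow> 'b::real_normed_vector) \<Rightarrow> bool" where
  "smooth_on S f \<longleftrightarrow> (\<forall>k. Ck_on k S f)"


section \<open>Submanifolds of a Euclidean space\<close>

text \<open>
  \<open>M\<close> is an embedded submanifold of a Euclidean space with the induced metric.  Vector fields on \<open>M\<close>
  are maps into the ambient space, and only their values on \<open>M\<close> matter.
\<close>

definition curve_through ::
    "'a::euclidean_space set \<Rightarrow> 'a \<Rightarrow> 'a \<Rightarrow> (real \<Rightarrow> 'a) \<Rightarrow> bool" where
  "curve_through M p v c \<longleftrightarrow>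
     (\<exists>e>0. smooth_on {-e<..<e} c \<and> c ` {-e<..<e} \<subseteq> M) \<and>
     c 0 = p \<and> (c has_vector_derivative v) (at 0)"

definition tangent_space :: "'a::euclidean_space set \<Rightarrow> 'a \<Rightarrow> 'a set" where
  "tangent_space M p = {v. \<exists>c. curve_through M p v c}"

definition tangent_part :: "'a::euclidean_space set \<Rightarrow> 'a \<Rightarrow> 'a \<Rightarrow> 'a" where
  "tangent_part M p v = closest_point (tangent_space M p) v"

definition smooth_vector_field :: "'a::euclidean_space set \<Rightarrow> ('a \<Rightarrow> 'a) \<Rightarrow> bool" where
  "smooth_vector_field M X \<longleftrightarrow>
     (\<forall>p\<in>M. X p \<in> tangent_space M p) \<and>
     (\<forall>p\<in>M. \<exists>U F. open U \<and> p \<in> U \<and> smooth_on U F \<and> (\<forall>q\<in>U \<inter> M. F q = X q))"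

text \<open>The derivative \<open>df\<^sub>p(v)\<close> of a map on \<open>M\<close>; it does not refer to an extension of \<open>f\<close>.\<close>

definition deriv_along ::
    "'a::euclidean_space set \<Rightarrow> ('a \<Rightarrow> 'b::real_normed_vector) \<Rightarrow> 'a \<Rightarrow> 'a \<Rightarrow> 'b" where
  "deriv_along M f p v =
     (THE w. \<forall>c. curve_through M p v c \<longrightarrow> ((f \<circ> c) has_vector_derivative w) (at 0))"

text \<open>
  The Levi-Civita connection of the induced metric is the tangential part of the ambient flat
  connection, both for fields on \<open>M\<close> and for fields along a curve in \<open>M\<close>.  It is unchanged when
  the metric is multiplied by a positive constant.
\<close>

definition nabla ::
    "'a::euclidean_space set \<Rightarrow> ('a \<Rightarrow> 'a) \<Rightarrow> ('a \<Rightarrow> 'a) \<Rightarrow> 'a \<Rightarrow> 'a" where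
  "nabla M X Y p = tangent_part M p (deriv_along M Y p (X p))"

definition lie_bracket ::
    "'a::euclidean_space set \<Rightarrow> ('a \<Rightarrow> 'a) \<Rightarrow> ('a \<Rightarrow> 'a) \<Rightarrow> 'a \<Rightarrow> 'a" where
  "lie_bracket M X Y p = deriv_along M Y p (X p) - deriv_along M X p (Y p)"

definition cov_deriv ::
    "'a::euclidean_space set \<Rightarrow> real set \<Rightarrow> (real \<Rightarrow> 'a) \<Rightarrow> (real \<Rightarrow> 'a) \<Rightarrow> real \<Rightarrow> 'a" where
  "cov_deriv M I \<gamma> V t = tangent_part M (\<gamma> t) (vector_derivative V (at t within I))"

text \<open>
  \<open>R(x,y)z\<close> at \<open>p\<close>: the common value at \<open>p\<close> of the curvature expression over all vector fields
  that extend \<open>x\<close>, \<open>y\<close>, \<open>z\<close>.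
\<close>

definition riemann ::
    "'a::euclidean_space set \<Rightarrow> 'a \<Rightarrow> 'a \<Rightarrow> 'a \<Rightarrow> 'a \<Rightarrow> 'a" where
  "riemann M p x y z =
     (THE w. \<forall>X Y Z. smooth_vector_field M X \<and> smooth_vector_field M Y \<and> smooth_vector_field M Z \<and>
        X p = x \<and> Y p = y \<and> Z p = z \<longrightarrow>
        w = nabla M X (nabla M Y Z) p - nabla M Y (nabla M X Z) p - nabla M (lie_bracket M X Y) Z p)"


section \<open>Biharmonic curves\<close>

text \<open>
  The traces in the tension and bitension fields run over the unit field \<open>d/dt\<close> of the interval
  \<open>I\<close>, which is parallel.
\<close>

definition velocity :: "real set \<Rightarrow> (real \<Rightarrow> 'a::real_normed_vector) \<Rightarrow> real \<Rightarrow> 'a" where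
  "velocity I \<gamma> t = vector_derivative \<gamma> (at t within I)"

definition tension ::
    "'a::euclidean_space set \<Rightarrow> real set \<Rightarrow> (real \<Rightarrow> 'a) \<Rightarrow> real \<Rightarrow> 'a" where
  "tension M I \<gamma> = cov_deriv M I \<gamma> (velocity I \<gamma>)"

definition rough_laplacian ::
    "'a::euclidean_space set \<Rightarrow> real set \<Rightarrow> (real \<Rightarrow> 'a) \<Rightarrow> (real \<Rightarrow> 'a) \<Rightarrow> real \<Rightarrow> 'a" where
  "rough_laplacian M I \<gamma> V t = - cov_deriv M I \<gamma> (cov_deriv M I \<gamma> V) t"

definition bitension ::
    "'a::euclidean_space set \<Rightarrow> real set \<Rightarrow> (real \<Rightarrow> 'a) \<Rightarrow> real \<Rightarrow> 'a" where
  "bitension M I \<gamma> t =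
     - rough_laplacian M I \<gamma> (tension M I \<gamma>) t
     - riemann M (\<gamma> t) (velocity I \<gamma> t) (tension M I \<gamma> t) (velocity I \<gamma> t)"

definition harmonic_curve :: "'a::euclidean_space set \<Rightarrow> real set \<Rightarrow> (real \<Rightarrow> 'a) \<Rightarrow> bool" where
  "harmonic_curve M I \<gamma> \<longleftrightarrow> (\<forall>t\<in>I. tension M I \<gamma> t = 0)"

definition biharmonic_curve :: "'a::euclidean_space set \<Rightarrow> real set \<Rightarrow> (real \<Rightarrow> 'a) \<Rightarrow> bool" where
  "biharmonic_curve M I \<gamma> \<longleftrightarrow> (\<forall>t\<in>I. bitension M I \<gamma> t = 0)"

definition proper_biharmonic_curve ::
    "'a::euclidean_space set \<Rightarrow> real set \<Rightarrow> (real \<Rightarrow> 'a) \<Rightarrow> bool" where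
  "proper_biharmonic_curve M I \<gamma> \<longleftrightarrow> biharmonic_curve M I \<gamma> \<and> \<not> harmonic_curve M I \<gamma>"


section \<open>Complex projective space\<close>

definition outer :: "complex^'m \<Rightarrow> complex^'m \<Rightarrow> complex^'m^'m::finite" where
  "outer v w = (\<chi> i j. v $ i * cnj (w $ j))"

text \<open>
  The line spanned by a unit vector \<open>z\<close> is represented by the orthogonal projector \<open>z z\<^sup>*\<close> onto it,
  so \<open>hopf\<close> is the Hopf fibration of the unit sphere over \<open>CP\<close>, and \<open>CP\<close> is a submanifold of the
  space of complex matrices.  The complex dimension of \<open>CP\<close> is \<open>CARD('m) - 1\<close>.
\<close>

definition hopf :: "complex^'m::finite \<Rightarrow> complex^'m^'m" where
  "hopf z = outer z z"

definition CP :: "(complex^'m::finite^'m) set" where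
  "CP = hopf ` sphere 0 1"

text \<open>
  The inner product of matrices is the real part of \<open>tr(A\<^sup>* B)\<close>.  The factor \<open>1/2\<close> makes \<open>hopf\<close> a
  Riemannian submersion from the unit sphere (\<open>fs_metric_hopf\<close>), which is the normalization with
  holomorphic sectional curvature \<open>4\<close>.
\<close>

definition fs_metric :: "complex^'m::finite^'m \<Rightarrow> complex^'m^'m \<Rightarrow> real" where
  "fs_metric X Y = (X \<bullet> Y) / 2"

text \<open>\<open>J X = i [X, P]\<close>, which corresponds to multiplication of horizontal vectors by \<open>i\<close>
  (\<open>cplx_struct_hopf\<close>).\<close>

definition cplx_struct :: "complex^'m::finite^'m \<Rightarrow> complex^'m^'m \<Rightarrow> complex^'m^'m" where
  "cplx_struct P X = (\<chi> i j. \<i> * (X ** P - P ** X) $ i $ j)"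

definition cinner :: "complex^'m::finite \<Rightarrow> complex^'m \<Rightarrow> complex" where
  "cinner v w = (\<Sum>i\<in>UNIV. v $ i * cnj (w $ i))"

definition hopf_deriv :: "complex^'m::finite \<Rightarrow> complex^'m \<Rightarrow> complex^'m^'m" where
  "hopf_deriv z v = outer v z + outer z v"

lemma cinner_self: "cinner z z = complex_of_real ((norm z)\<^sup>2)"
  unfolding cinner_def
  by (simp add: norm_vec_def L2_set_def sum_nonneg complex_norm_square flip: of_real_power)

lemma Re_cinner: "Re (cinner v w) = v \<bullet> w"
  by (simp add: cinner_def inner_vec_def inner_complex_def)

lemma cnj_cinner: "cnj (cinner v w) = cinner w v"
  by (simp add: cinner_def mult.commute)

lemma hopf_eq_iff:
  assumes "norm z = 1" "norm w = 1"
  shows "hopf z = hopf w \<longleftrightarrow> (\<exists>c. cmod c = 1 \<and> w = c *s z)"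
proof
  assume eq: "hopf z = hopf w"
  have "w = cinner w z *s z"
  proof -
    have e: "w $ i * cnj (w $ j) = z $ i * cnj (z $ j)" for i j
      using eq by (simp add: hopf_def outer_def vec_eq_iff)
    have "w $ i = cinner w z * z $ i" for i
    proof -
      have "w $ i = w $ i * cinner w w"
        by (simp add: cinner_self assms)
      also have "\<dots> = (\<Sum>j\<in>UNIV. (w $ i * cnj (w $ j)) * w $ j)"
        by (simp add: cinner_def sum_distrib_left algebra_simps)
      also have "\<dots> = cinner w z * z $ i"
        by (simp add: e cinner_def sum_distrib_left algebra_simps)
      finally show ?thesis .
    qed
    then show ?thesis by (simp add: vec_eq_iff)
  qed
  moreover have "norm (c *s z) = cmod c * norm z" for c
    by (simp add: norm_vec_def norm_mult L2_set_right_distrib)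
  ultimately show "\<exists>c. cmod c = 1 \<and> w = c *s z"
    using assms by (metis mult.right_neutral)
next
  assume "\<exists>c. cmod c = 1 \<and> w = c *s z"
  then obtain c where c: "cmod c = 1" "w = c *s z" by blast
  have "c * cnj c = 1"
    using c(1) by (simp flip: complex_norm_square)
  then have "c * z $ i * (cnj c * cnj (z $ j)) = z $ i * cnj (z $ j)" for i j
    by (simp add: ac_simps)
  then show "hopf z = hopf w"
    by (simp add: c(2) hopf_def outer_def vec_eq_iff)
qed

lemma bounded_bilinear_outer: "bounded_bilinear outer"
  unfolding bilinear_conv_bounded_bilinear [symmetric] bilinear_def outer_def
  by (auto intro!: linearI simp: vec_eq_iff complex_eq_iff algebra_simps)

lemma hopf_has_derivative: "(hopf has_derivative hopf_deriv z) (at z)"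
proof -
  have "(hopf has_derivative (\<lambda>h. outer z h + outer h z)) (at z)"
    unfolding hopf_def [abs_def]
    by (rule bounded_bilinear.FDERIV [OF bounded_bilinear_outer has_derivative_ident has_derivative_ident])
  then show ?thesis
    by (simp add: hopf_deriv_def [abs_def] add.commute)
qed

lemma inner_outer: "outer a b \<bullet> outer c d = Re (cinner a c * cinner d b)"
proof -
  have "cinner a c * cinner d b =
      (\<Sum>i\<in>UNIV. \<Sum>j\<in>UNIV. (a $ i * cnj (b $ j)) * cnj (c $ i * cnj (d $ j)))"
    by (simp add: cinner_def sum_product algebra_simps)
  moreover have "Re (x * cnj y) = x \<bullet> y" for x y
    by (simp add: inner_complex_def)
  ultimately show ?thesis
    by (simp only: outer_def inner_vec_def vec_lambda_beta Re_sum)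
qed

lemma fs_metric_hopf:
  assumes "norm z = 1" "cinner v z = 0" "cinner w z = 0"
  shows "fs_metric (hopf_deriv z v) (hopf_deriv z w) = v \<bullet> w"
proof -
  have "cinner z v = 0" "cinner z w = 0" "cinner z z = 1"
    using assms by (auto simp: cinner_self simp flip: cnj_cinner[of v z] cnj_cinner[of w z])
  then show ?thesis
    using assms
    by (simp add: fs_metric_def hopf_deriv_def inner_add_left inner_add_right inner_outer
        Re_cinner inner_commute)
qed

lemma outer_mult: "outer a b ** outer c d = (\<chi> i j. cinner c b * outer a d $ i $ j)"
  by (simp add: outer_def matrix_matrix_mult_def cinner_def vec_eq_iff sum_distrib_left
      sum_distrib_right algebra_simps)

lemma bounded_bilinear_matrix_mult:
  "bounded_bilinear ((**) :: complex^'m::finite^'m \<Rightarrow> complex^'m^'m \<Rightarrow> complex^'m^'m)"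
  unfolding bilinear_conv_bounded_bilinear [symmetric] bilinear_def matrix_matrix_mult_def
  by (auto intro!: linearI simp: vec_eq_iff sum.distrib scaleR_sum_right algebra_simps)

lemma cplx_struct_hopf:
  assumes "norm z = 1" "cinner v z = 0"
  shows "cplx_struct (hopf z) (hopf_deriv z v) = hopf_deriv z (\<i> *s v)"
proof -
  have "cinner z v = 0" "cinner z z = 1"
    using assms by (auto simp: cinner_self simp flip: cnj_cinner[of v z])
  then show ?thesis
    using assms
    by (simp add: cplx_struct_def hopf_def hopf_deriv_def outer_mult vec_eq_iff
        bounded_bilinear.add_left [OF bounded_bilinear_matrix_mult]
        bounded_bilinear.add_right [OF bounded_bilinear_matrix_mult]) (simp add: outer_def algebra_simps)
qed


subsection \<open>The Levi-Civita connection of \<open>CP\<close>\<close>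

text \<open>
  \<open>nabla CP\<close> is metric (\<open>nabla_CP_metric\<close>) and torsion-free (\<open>nabla_CP_torsion_free\<close>), hence it
  is the Levi-Civita connection of the Fubini-Study metric.
\<close>

definition adjoint_mat :: "complex^'m::finite^'m \<Rightarrow> complex^'m^'m" where
  "adjoint_mat A = (\<chi> i j. cnj (A $ j $ i))"

lemma bounded_linear_adjoint_mat: "bounded_linear adjoint_mat"
  unfolding linear_conv_bounded_linear [symmetric] adjoint_mat_def
  by (auto intro!: linearI simp: vec_eq_iff complex_eq_iff)

lemma CP_idem: "P \<in> CP \<Longrightarrow> P ** P = P"
  by (auto simp: CP_def hopf_def outer_mult cinner_self vec_eq_iff)

lemma CP_adjoint: "P \<in> CP \<Longrightarrow> adjoint_mat P = P"
  by (auto simp: CP_def hopf_def outer_def adjoint_mat_def vec_eq_iff)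

lemma Ck_on_cong:
  assumes "\<And>x. x \<in> S \<Longrightarrow> f x = g x"
  shows "Ck_on k S f \<longleftrightarrow> Ck_on k S g"
  using assms
proof (induction k arbitrary: f g)
  case 0
  then show ?case by (simp cong: continuous_on_cong)
next
  case (Suc k)
  have D: "(f has_derivative D) (at x within S) \<longleftrightarrow> (g has_derivative D) (at x within S)"
    if "x \<in> S" for x D
    using Suc.prems that by (metis has_derivative_transform)
  then have "f differentiable_on S \<longleftrightarrow> g differentiable_on S"
    by (simp add: differentiable_on_def differentiable_def)
  moreover have "frechet_derivative f (at x within S) = frechet_derivative g (at x within S)"
    if "x \<in> S" for x
    using D [OF that] by (simp add: frechet_derivative_def)
  ultimately show ?case
    using Suc.IH by (metis (no_types, lifting) Ck_on.simps(2))
qed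

lemma smooth_on_trig:
  fixes a b d :: "'a::real_normed_vector"
  assumes S: "open S"
  shows "smooth_on S (\<lambda>t::real. cos (w * t) *\<^sub>R a + sin (w * t) *\<^sub>R b + d)"
proof -
  have "Ck_on k S (\<lambda>t::real. cos (w * t) *\<^sub>R a + sin (w * t) *\<^sub>R b + d)" for k and a b d :: 'a
  proof (induction k arbitrary: a b d)
    case 0
    show ?case by (auto intro!: continuous_intros)
  next
    case (Suc k)
    let ?f = "\<lambda>t::real. cos (w * t) *\<^sub>R a + sin (w * t) *\<^sub>R b + d"
    have D: "(?f has_derivative
        (\<lambda>v. cos (w * t) *\<^sub>R ((v * w) *\<^sub>R b) + sin (w * t) *\<^sub>R (- (v * w) *\<^sub>R a) + 0)) (at t)" for t
      by (auto intro!: derivative_eq_intros simp: fun_eq_iff algebra_simps)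
    then have "?f differentiable_on S"
      by (meson differentiable_at_withinI differentiableI differentiable_on_def)
    moreover have "frechet_derivative ?f (at t within S) v =
        cos (w * t) *\<^sub>R ((v * w) *\<^sub>R b) + sin (w * t) *\<^sub>R (- (v * w) *\<^sub>R a) + 0" if "t \<in> S" for t v
      by (simp only: at_within_open [OF that S] frechet_derivative_at [OF D [of t], symmetric])
    then have "Ck_on k S (\<lambda>t. frechet_derivative ?f (at t within S) v)" for v
      using Suc.IH [of "(v * w) *\<^sub>R b" "- (v * w) *\<^sub>R a" 0]
      by (subst Ck_on_cong [where g = "\<lambda>t. cos (w * t) *\<^sub>R ((v * w) *\<^sub>R b) + sin (w * t) *\<^sub>R (- (v * w) *\<^sub>R a) + 0"]) auto
    ultimately show ?case
      by simp
  qed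
  then show ?thesis by (simp add: smooth_on_def)
qed

lemma hopf_deriv_tangent:
  assumes z: "norm z = 1" and v: "cinner v z = 0"
  shows "hopf_deriv z v \<in> tangent_space CP (hopf z)"
proof -
  define u where "u = sgn v"
  define w where "w = 2 * norm v"
  define c where "c = (\<lambda>t::real. cos (w * t) *\<^sub>R ((1/2) *\<^sub>R (hopf z - hopf u)) +
     sin (w * t) *\<^sub>R ((1/2) *\<^sub>R (outer u z + outer z u)) + (1/2) *\<^sub>R (hopf z + hopf u))"
  interpret O: bounded_bilinear "outer :: complex^'a \<Rightarrow> _"
    by (rule bounded_bilinear_outer)
  have "v \<bullet> z = 0"
    using v by (simp flip: Re_cinner)
  then have uz: "z \<bullet> u = 0"
    by (simp add: u_def sgn_div_norm inner_commute)
  have vu: "v = norm v *\<^sub>R u"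
    by (cases "v = 0") (auto simp: u_def sgn_div_norm)
  have c_hopf: "c t = hopf (cos (norm v * t) *\<^sub>R z + sin (norm v * t) *\<^sub>R u)" for t
  proof -
    have w: "w * t = 2 * (norm v * t)"
      by (simp add: w_def)
    define s where "s = norm v * t"
    have eq: "cos s * cos s = (1 + cos (2 * s)) / 2" "sin s * sin s = (1 - cos (2 * s)) / 2"
      "sin s * cos s = sin (2 * s) / 2" "cos s * sin s = sin (2 * s) / 2"
      using cos_double [of s] sin_double [of s] sin_cos_squared_add [of s]
      by (auto simp: power2_eq_square)
    show ?thesis
      unfolding c_def w hopf_def s_def [symmetric] O.add_left O.add_right O.scaleR_left O.scaleR_right
        scaleR_add_right scaleR_scaleR eq
      by (simp add: algebra_simps add_divide_distrib diff_divide_distrib)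
  qed
  have c_CP: "c t \<in> CP" for t
  proof (cases "v = 0")
    case True
    then show ?thesis using z by (simp add: c_hopf CP_def)
  next
    case False
    then have "u \<bullet> u = 1" "z \<bullet> z = 1"
      by (simp_all add: u_def norm_sgn z dot_square_norm)
    then have "norm (cos (norm v * t) *\<^sub>R z + sin (norm v * t) *\<^sub>R u) = 1"
      unfolding norm_eq_1
      by (simp add: inner_add_left inner_add_right inner_commute [of u z] uz flip: power2_eq_square)
    then show ?thesis
      by (simp add: c_hopf CP_def)
  qed
  have "(c has_vector_derivative w *\<^sub>R ((1/2) *\<^sub>R (outer u z + outer z u))) (at 0)"
    unfolding c_def by (auto intro!: derivative_eq_intros)
  also have "w *\<^sub>R ((1/2) *\<^sub>R (outer u z + outer z u)) = hopf_deriv z v"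
    using arg_cong [OF vu, of "hopf_deriv z"]
    by (simp add: w_def hopf_deriv_def O.scaleR_left O.scaleR_right scaleR_add_right)
  finally have "(c has_vector_derivative hopf_deriv z v) (at 0)" .
  moreover have "smooth_on {- 1<..<1} c"
    unfolding c_def by (rule smooth_on_trig) simp
  moreover have "c 0 = hopf z"
    by (simp add: c_hopf)
  ultimately show ?thesis
    unfolding tangent_space_def curve_through_def using c_CP
    by (auto intro!: exI [of _ c] exI [of _ 1])
qed

lemma curve_eventually_in:
  assumes "curve_through M p v c"
  shows "\<forall>\<^sub>F s in nhds 0. c s \<in> M"
proof -
  from assms obtain e where "e > 0" "c ` {-e<..<e} \<subseteq> M"
    by (auto simp: curve_through_def)
  then show ?thesis
    unfolding eventually_nhds by (intro exI [of _ "{-e<..<e}"]) auto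
qed

lemma has_vector_derivative_unique_germ:
  assumes "(f has_vector_derivative f') (at 0)" "(g has_vector_derivative g') (at 0)"
    and "\<forall>\<^sub>F s in nhds (0::real). f s = g s"
  shows "f' = g'"
proof -
  have "(f has_vector_derivative g') (at 0)"
    using assms(2,3) unfolding has_vector_derivative_def
    by (rule_tac has_derivative_transform_eventually [where f = g])
      (auto dest: eventually_nhds_x_imp_x simp: eventually_at_filter elim: eventually_mono)
  then show ?thesis
    using assms(1) vector_derivative_unique_at by blast
qed

lemma bounded_linear_deriv_curve:
  assumes "bounded_linear L" "(c has_vector_derivative v) (at t)"
  shows "((\<lambda>s. L (c s)) has_vector_derivative L v) (at t)"
  using assms bounded_linear.has_vector_derivative by blast

lemma deriv_idem:
  fixes c :: "real \<Rightarrow> complex^'m::finite^'m"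
  assumes "curve_through CP P X c" "(V has_vector_derivative D) (at 0)"
    "\<And>s. c s \<in> CP \<Longrightarrow> V s ** c s + c s ** V s = V s"
  shows "(V 0 ** X + D ** P) + (P ** D + X ** V 0) = D"
proof -
  interpret B: bounded_bilinear "(**) :: complex^'m^'m \<Rightarrow> complex^'m^'m \<Rightarrow> complex^'m^'m"
    by (rule bounded_bilinear_matrix_mult)
  have c: "c 0 = P" "(c has_vector_derivative X) (at 0)"
    using assms(1) by (auto simp: curve_through_def)
  have "((\<lambda>s. V s ** c s + c s ** V s) has_vector_derivative
      (V 0 ** X + D ** P) + (P ** D + X ** V 0)) (at 0)"
    using has_vector_derivative_add [OF B.has_vector_derivative [OF assms(2) c(2)]
        B.has_vector_derivative [OF c(2) assms(2)]] by (simp add: c(1))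
  moreover have "\<forall>\<^sub>F s in nhds 0. V s ** c s + c s ** V s = V s"
    using curve_eventually_in [OF assms(1)] by eventually_elim (rule assms(3))
  ultimately show ?thesis
    using assms(2) has_vector_derivative_unique_germ by blast
qed

lemma deriv_adjoint:
  fixes c :: "real \<Rightarrow> complex^'m::finite^'m"
  assumes "curve_through CP P X c" "(V has_vector_derivative D) (at 0)"
    "\<And>s. c s \<in> CP \<Longrightarrow> adjoint_mat (V s) = V s"
  shows "adjoint_mat D = D"
proof -
  have "((\<lambda>s. adjoint_mat (V s)) has_vector_derivative adjoint_mat D) (at 0)"
    using assms(2) bounded_linear_adjoint_mat by (rule bounded_linear_deriv_curve [rotated])
  moreover have "\<forall>\<^sub>F s in nhds 0. adjoint_mat (V s) = V s"
    using curve_eventually_in [OF assms(1)] by eventually_elim (rule assms(3))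
  ultimately show ?thesis
    using assms(2) has_vector_derivative_unique_germ by blast
qed

lemma tangent_hopf_deriv:
  assumes z: "norm z = 1" and X: "adjoint_mat X = X" "X ** hopf z + hopf z ** X = X"
  shows "\<exists>v. cinner v z = 0 \<and> X = hopf_deriv z v"
proof -
  define v where "v = X *v z"
  have adj: "cnj (X $ i $ j) = X $ j $ i" for i j
  proof -
    have "adjoint_mat X $ j $ i = X $ j $ i" by (simp only: X(1))
    then show ?thesis by (simp add: adjoint_mat_def)
  qed
  have XP: "X ** hopf z = outer v z"
    by (simp add: v_def hopf_def outer_def matrix_matrix_mult_def matrix_vector_mult_def vec_eq_iff
        sum_distrib_left algebra_simps)
  have PX: "hopf z ** X = outer z v"
    by (simp add: v_def hopf_def outer_def matrix_matrix_mult_def matrix_vector_mult_def vec_eq_iff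
        sum_distrib_left adj algebra_simps)
  have eq: "X = hopf_deriv z v"
    using X(2) by (simp add: hopf_deriv_def XP PX)
  have "v = hopf_deriv z v *v z"
    using eq v_def by simp
  also have "\<dots> = cinner z z *s v + cinner z v *s z"
    by (simp add: hopf_deriv_def outer_def matrix_vector_mult_def cinner_def vec_eq_iff sum.distrib
        sum_distrib_left sum_distrib_right algebra_simps)
  finally have "cinner z v *s z = 0" by (simp add: cinner_self z)
  moreover have "z \<noteq> 0" using z by auto
  ultimately have "cinner z v = 0" by (metis vector_mul_eq_0)
  then have "cinner v z = 0" by (metis cnj_cinner complex_cnj_zero)
  with eq show ?thesis by blast
qed

lemma tangent_space_CP_eq:
  assumes P: "P \<in> CP"
  shows "tangent_space CP P = {X. adjoint_mat X = X \<and> X ** P + P ** X = X}" (is "?T = ?S")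
proof (intro equalityI subsetI)
  fix X assume "X \<in> ?T"
  then obtain c where c: "curve_through CP P X c"
    by (auto simp: tangent_space_def)
  have dc: "c 0 = P" "(c has_vector_derivative X) (at 0)"
    using c by (auto simp: curve_through_def)
  interpret B: bounded_bilinear "(**) :: complex^'a^'a \<Rightarrow> complex^'a^'a \<Rightarrow> complex^'a^'a"
    by (rule bounded_bilinear_matrix_mult)
  have "((\<lambda>s. c s ** c s) has_vector_derivative P ** X + X ** P) (at 0)"
    using B.has_vector_derivative [OF dc(2) dc(2)] by (simp add: dc(1))
  moreover have "\<forall>\<^sub>F s in nhds 0. c s ** c s = c s"
    using curve_eventually_in [OF c] by eventually_elim (rule CP_idem)
  ultimately have "P ** X + X ** P = X"
    using dc(2) has_vector_derivative_unique_germ by blast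
  moreover have "adjoint_mat X = X"
    using deriv_adjoint [OF c dc(2)] CP_adjoint by blast
  ultimately show "X \<in> ?S" by (simp add: add.commute)
next
  fix X assume X: "X \<in> ?S"
  from P obtain z where z: "norm z = 1" "P = hopf z"
    by (auto simp: CP_def)
  show "X \<in> ?T"
    using tangent_hopf_deriv [OF z(1), of X] hopf_deriv_tangent [OF z(1)] X z(2) by auto
qed

lemma tangent_space_hopf:
  assumes "norm z = 1"
  shows "tangent_space CP (hopf z) = hopf_deriv z ` {v. cinner v z = 0}"
proof -
  have "hopf z \<in> CP" using assms by (auto simp: CP_def)
  have "\<exists>v. cinner v z = 0 \<and> X = hopf_deriv z v" if "X \<in> tangent_space CP (hopf z)" for X
    using that tangent_hopf_deriv [OF assms, of X]
    unfolding tangent_space_CP_eq [OF \<open>hopf z \<in> CP\<close>] by blast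
  then show ?thesis using hopf_deriv_tangent [OF assms] by blast
qed

lemma subspace_tangent_space_CP:
  assumes "P \<in> CP" shows "subspace (tangent_space CP P)"
proof -
  interpret B: bounded_bilinear "(**) :: complex^'a^'a \<Rightarrow> complex^'a^'a \<Rightarrow> complex^'a^'a"
    by (rule bounded_bilinear_matrix_mult)
  interpret L: bounded_linear "adjoint_mat :: complex^'a^'a \<Rightarrow> _"
    by (rule bounded_linear_adjoint_mat)
  show ?thesis
    unfolding tangent_space_CP_eq [OF assms] subspace_def
    by (auto simp: L.zero L.add L.scaleR B.zero_left B.zero_right B.add_left B.add_right
        B.scaleR_left B.scaleR_right simp flip: scaleR_add_right)
      (metis (no_types, opaque_lifting) add.assoc add.left_commute)
qed

lemma tangent_part_mem:
  assumes "subspace (tangent_space M p)"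
  shows "tangent_part M p a \<in> tangent_space M p"
  unfolding tangent_part_def
  by (rule closest_point_in_set) (use assms closed_subspace subspace_0 in auto)

lemma tangent_part_orthogonal:
  assumes T: "subspace (tangent_space M p)" and x: "x \<in> tangent_space M p"
  shows "tangent_part M p a \<bullet> x = a \<bullet> x"
proof -
  let ?T = "tangent_space M p"
  define b where "b = tangent_part M p a"
  have b: "b \<in> ?T" unfolding b_def by (rule tangent_part_mem [OF T])
  have "(a - b) \<bullet> (y - b) \<le> 0" if "y \<in> ?T" for y
    unfolding b_def tangent_part_def
    by (rule closest_point_dot) (use T that closed_subspace subspace_imp_convex in auto)
  from this [of "b + x"] this [of "b - x"] have "(a - b) \<bullet> x = 0"
    using b x T by (simp add: subspace_add subspace_diff)
  then show ?thesis by (simp add: b_def inner_diff_left)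
qed

lemma tangent_part_unique:
  assumes T: "subspace (tangent_space M p)" and "b \<in> tangent_space M p"
    and "\<And>x. x \<in> tangent_space M p \<Longrightarrow> b \<bullet> x = a \<bullet> x"
  shows "tangent_part M p a = b"
proof -
  let ?d = "tangent_part M p a - b"
  have "?d \<in> tangent_space M p"
    using assms tangent_part_mem subspace_diff by blast
  then have "?d \<bullet> ?d = 0"
    using assms tangent_part_orthogonal [OF T] by (simp add: inner_diff_left)
  then show ?thesis by simp
qed

lemma smooth_vector_field_curve:
  assumes "smooth_vector_field M X" "p \<in> M"
  obtains L where "linear L"
    "\<And>v c. curve_through M p v c \<Longrightarrow> ((X \<circ> c) has_vector_derivative L v) (at 0)"
proof -
  from assms obtain U F where U: "open U" "p \<in> U" "smooth_on U F" "\<And>q. q \<in> U \<inter> M \<Longrightarrow> F q = X q"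
    unfolding smooth_vector_field_def by metis
  have "Ck_on 1 U F" using U(3) by (simp add: smooth_on_def)
  then have "F differentiable_on U" by simp
  then obtain L where L: "(F has_derivative L) (at p)"
    using U by (metis at_within_open differentiable_def differentiable_on_def)
  show ?thesis
  proof
    show "linear L" using L has_derivative_linear by blast
    fix v c assume c: "curve_through M p v c"
    then have dc: "c 0 = p" "(c has_vector_derivative v) (at 0)"
      by (auto simp: curve_through_def)
    have FL: "((F \<circ> c) has_vector_derivative L v) (at 0)"
      using vector_derivative_diff_chain_within [of c v 0 UNIV F L] L dc
      by (simp add: has_derivative_at_withinI)
    have "isCont c 0" using dc(2) has_vector_derivative_continuous by blast
    then have "(c \<longlongrightarrow> c 0) (nhds 0)"
      by (simp add: isCont_def tendsto_at_iff_tendsto_nhds)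
    then have "\<forall>\<^sub>F s in nhds 0. c s \<in> U"
      by (rule topological_tendstoD) (use U dc(1) in auto)
    then have "\<forall>\<^sub>F s in nhds 0. (X \<circ> c) s = (F \<circ> c) s"
      using curve_eventually_in [OF c] by eventually_elim (use U(4) in auto)
    then show "((X \<circ> c) has_vector_derivative L v) (at 0)"
      using FL unfolding has_vector_derivative_def
      by (rule_tac has_derivative_transform_eventually [where f = "F \<circ> c"])
        (auto dest: eventually_nhds_x_imp_x simp: eventually_at_filter elim: eventually_mono)
  qed
qed

lemma deriv_alongI:
  assumes "v \<in> tangent_space M p"
    and "\<And>c. curve_through M p v c \<Longrightarrow> ((f \<circ> c) has_vector_derivative w) (at 0)"
  shows "deriv_along M f p v = w"
  unfolding deriv_along_def
proof (rule the_equality)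
  fix w' assume "\<forall>c. curve_through M p v c \<longrightarrow> ((f \<circ> c) has_vector_derivative w') (at 0)"
  then show "w' = w"
    using assms vector_derivative_unique_at unfolding tangent_space_def by blast
qed (use assms in blast)

lemma smooth_vector_field_deriv_along:
  assumes "smooth_vector_field M X" "p \<in> M" "curve_through M p v c"
  shows "((X \<circ> c) has_vector_derivative deriv_along M X p v) (at 0)"
proof -
  obtain L where L: "\<And>v c. curve_through M p v c \<Longrightarrow> ((X \<circ> c) has_vector_derivative L v) (at 0)"
    using smooth_vector_field_curve [OF assms(1,2)] by metis
  then have "deriv_along M X p v = L v"
    using assms(3) by (intro deriv_alongI) (auto simp: tangent_space_def)
  then show ?thesis using L assms(3) by simp
qed

lemma nabla_CP_metric:
  assumes "smooth_vector_field CP X" "smooth_vector_field CP Y" "smooth_vector_field CP Z" "P \<in> CP"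
  shows "deriv_along CP (\<lambda>q. fs_metric (Y q) (Z q)) P (X P) =
    fs_metric (nabla CP X Y P) (Z P) + fs_metric (Y P) (nabla CP X Z P)"
proof (rule deriv_alongI)
  have tan: "X P \<in> tangent_space CP P" "Y P \<in> tangent_space CP P" "Z P \<in> tangent_space CP P"
    using assms by (auto simp: smooth_vector_field_def)
  then show "X P \<in> tangent_space CP P" by simp
  note orth = tangent_part_orthogonal [OF subspace_tangent_space_CP [OF \<open>P \<in> CP\<close>]]
  fix c assume c: "curve_through CP P (X P) c"
  have "c 0 = P" using c by (simp add: curve_through_def)
  have "((\<lambda>s. (Y \<circ> c) s \<bullet> (Z \<circ> c) s) has_vector_derivative
      (Y \<circ> c) 0 \<bullet> deriv_along CP Z P (X P) + deriv_along CP Y P (X P) \<bullet> (Z \<circ> c) 0) (at 0)"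
    using bounded_bilinear.has_vector_derivative [OF bounded_bilinear_inner
        smooth_vector_field_deriv_along [OF assms(2) assms(4) c]
        smooth_vector_field_deriv_along [OF assms(3) assms(4) c]] .
  from has_vector_derivative_divide [OF this, of 2]
  show "((\<lambda>q. fs_metric (Y q) (Z q)) \<circ> c has_vector_derivative
      fs_metric (nabla CP X Y P) (Z P) + fs_metric (Y P) (nabla CP X Z P)) (at 0)"
    using tan \<open>c 0 = P\<close> orth
    by (simp add: fs_metric_def nabla_def o_def inner_commute add_divide_distrib add.commute)
qed

lemma lie_bracket_CP_tangent:
  assumes "smooth_vector_field CP X" "smooth_vector_field CP Y" "P \<in> CP"
  shows "lie_bracket CP X Y P \<in> tangent_space CP P"
proof -
  interpret B: bounded_bilinear "(**) :: complex^'a^'a \<Rightarrow> complex^'a^'a \<Rightarrow> complex^'a^'a"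
    by (rule bounded_bilinear_matrix_mult)
  interpret L: bounded_linear "adjoint_mat :: complex^'a^'a \<Rightarrow> _"
    by (rule bounded_linear_adjoint_mat)
  have field: "adjoint_mat (V q) = V q" "V q ** q + q ** V q = V q"
    if "smooth_vector_field CP V" "q \<in> CP" for V and q :: "complex^'a^'a"
    using that tangent_space_CP_eq [of q] by (auto simp: smooth_vector_field_def)
  have D: "adjoint_mat (deriv_along CP W P (V P)) = deriv_along CP W P (V P)"
    "(W P ** V P + deriv_along CP W P (V P) ** P) + (P ** deriv_along CP W P (V P) + V P ** W P) =
      deriv_along CP W P (V P)"
    if V: "smooth_vector_field CP V" and W: "smooth_vector_field CP W" for V W
  proof -
    have "V P \<in> tangent_space CP P"
      using V assms(3) by (auto simp: smooth_vector_field_def)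
    then obtain c where c: "curve_through CP P (V P) c"
      by (auto simp: tangent_space_def)
    note d = smooth_vector_field_deriv_along [OF W assms(3) c]
    have "c 0 = P" using c by (simp add: curve_through_def)
    show "adjoint_mat (deriv_along CP W P (V P)) = deriv_along CP W P (V P)"
      by (rule deriv_adjoint [OF c d]) (simp add: field(1) W)
    show "(W P ** V P + deriv_along CP W P (V P) ** P) + (P ** deriv_along CP W P (V P) + V P ** W P) =
        deriv_along CP W P (V P)"
      using deriv_idem [OF c d] field(2) [OF W] \<open>c 0 = P\<close> by simp
  qed
  define D1 D2 where "D1 = deriv_along CP Y P (X P)" and "D2 = deriv_along CP X P (Y P)"
  have 1: "(Y P ** X P + D1 ** P) + (P ** D1 + X P ** Y P) = D1"
    and 2: "(X P ** Y P + D2 ** P) + (P ** D2 + Y P ** X P) = D2"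
    using D(2) [OF assms(1,2)] D(2) [OF assms(2,1)] by (auto simp: D1_def D2_def)
  have "(D1 - D2) ** P + P ** (D1 - D2) =
      ((Y P ** X P + D1 ** P) + (P ** D1 + X P ** Y P)) -
      ((X P ** Y P + D2 ** P) + (P ** D2 + Y P ** X P))"
    by (simp add: B.diff_left B.diff_right)
  then have "(D1 - D2) ** P + P ** (D1 - D2) = D1 - D2"
    by (simp only: 1 2)
  then show ?thesis
    using D(1) [OF assms(1,2)] D(1) [OF assms(2,1)]
    by (simp add: tangent_space_CP_eq [OF assms(3)] lie_bracket_def L.diff D1_def D2_def)
qed

lemma nabla_CP_torsion_free:
  assumes "smooth_vector_field CP X" "smooth_vector_field CP Y" "P \<in> CP"
  shows "nabla CP X Y P - nabla CP Y X P = lie_bracket CP X Y P"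
proof -
  note T = subspace_tangent_space_CP [OF \<open>P \<in> CP\<close>]
  have "tangent_part CP P (deriv_along CP Y P (X P)) = lie_bracket CP X Y P + nabla CP Y X P"
  proof (rule tangent_part_unique [OF T])
    show "lie_bracket CP X Y P + nabla CP Y X P \<in> tangent_space CP P"
      unfolding nabla_def using lie_bracket_CP_tangent [OF assms] tangent_part_mem [OF T] T
      by (auto intro: subspace_add)
  qed (simp add: nabla_def lie_bracket_def inner_add_left inner_diff_left tangent_part_orthogonal [OF T])
  then show ?thesis by (simp add: nabla_def)
qed


section \<open>Frenet curves in complex projective space\<close>

text \<open>
  Frame fields and curvatures are indexed from \<open>1\<close>; only \<open>E 1, \<dots>, E d\<close> and \<open>k 1, \<dots>, k (d - 1)\<close> are
  relevant.  Unit speed is part of the orthonormality, as \<open>E 1\<close> is the velocity.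
\<close>

definition frenet_curve ::
    "real set \<Rightarrow> (real \<Rightarrow> complex^'m::finite^'m) \<Rightarrow> nat \<Rightarrow> (nat \<Rightarrow> real \<Rightarrow> complex^'m^'m) \<Rightarrow>
     (nat \<Rightarrow> real \<Rightarrow> real) \<Rightarrow> bool" where
  "frenet_curve I \<gamma> d E k \<longleftrightarrow>
     1 \<le> d \<and> d \<le> 2 * (CARD('m) - 1) \<and>
     smooth_on I \<gamma> \<and> \<gamma> ` I \<subseteq> CP \<and>
     (\<forall>i\<in>{1..d}. smooth_on I (E i) \<and> (\<forall>t\<in>I. E i t \<in> tangent_space CP (\<gamma> t))) \<and>
     (\<forall>t\<in>I. \<forall>i\<in>{1..d}. \<forall>j\<in>{1..d}. fs_metric (E i t) (E j t) = (if i = j then 1 else 0)) \<and>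
     (\<forall>t\<in>I. E 1 t = velocity I \<gamma> t) \<and>
     (\<forall>i\<in>{1..<d}. \<forall>t\<in>I. k i t > 0) \<and>
     (\<forall>i\<in>{1..d}. \<forall>t\<in>I. cov_deriv CP I \<gamma> (E i) t =
        (if i = 1 then 0 else - k (i - 1) t *\<^sub>R E (i - 1) t) +
        (if i = d then 0 else k i t *\<^sub>R E (i + 1) t))"

definition frenet_helix ::
    "real set \<Rightarrow> (real \<Rightarrow> complex^'m::finite^'m) \<Rightarrow> nat \<Rightarrow> (nat \<Rightarrow> real \<Rightarrow> complex^'m^'m) \<Rightarrow>
     (nat \<Rightarrow> real \<Rightarrow> real) \<Rightarrow> bool" where
  "frenet_helix I \<gamma> d E k \<longleftrightarrow>
     frenet_curve I \<gamma> d E k \<and> (\<forall>i\<in>{1..<d}. \<exists>c>0. \<forall>t\<in>I. k i t = c)"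

definition complex_torsion ::
    "(real \<Rightarrow> complex^'m::finite^'m) \<Rightarrow> (nat \<Rightarrow> real \<Rightarrow> complex^'m^'m) \<Rightarrow> nat \<Rightarrow> nat \<Rightarrow> real \<Rightarrow> real" where
  "complex_torsion \<gamma> E i j t = fs_metric (E i t) (cplx_struct (\<gamma> t) (E j t))"

end

theory Submission
  imports Defs
begin

text \<open>
  Everything rests on two formulas. On the set of rank one projectors, the tangential part of a
  Hermitian matrix \<open>A\<close> at \<open>P\<close> is \<open>P A + A P - 2 P A P\<close>, so the connection and its curvature are
  matrix polynomials, and differentiating the projection twice gives \<open>R(X, Y) Z = [[X, Y], Z]\<close>
  (\<open>riemann_CP\<close>). If \<open>X\<close> is a unit vector orthogonal to \<open>Y\<close> and to \<open>J Y\<close>, the triple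
  product \<open>X Y X\<close> vanishes and what remains is \<open>R(X, Y) X = - Y\<close>
  (\<open>riemann_CP_totally_real\<close>): such planes have sectional curvature \<open>1\<close>. Along a curve with
  \<open>\<tau>\<^sub>1\<^sub>2 = 0\<close> the curvature term of the bitension field is therefore that of a unit sphere.

  The tension field is \<open>k\<^sub>1 E\<^sub>2\<close>. Differentiating it twice by the Frenet equations and adding the
  curvature term yields (\<open>bitension_eq\<close>)
  \<open>\<tau>\<^sub>2 = - 3 k\<^sub>1 k\<^sub>1' E\<^sub>1 + (k\<^sub>1'' - k\<^sub>1\<^sup>3 - k\<^sub>1 k\<^sub>2\<^sup>2 + k\<^sub>1) E\<^sub>2 + (2 k\<^sub>1' k\<^sub>2 + k\<^sub>1 k\<^sub>2') E\<^sub>3 + k\<^sub>1 k\<^sub>2 k\<^sub>3 E\<^sub>4\<close>.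
  As the frame is orthonormal, all four coefficients vanish for a biharmonic curve: \<open>k\<^sub>1\<close> and \<open>k\<^sub>2\<close> are
  constant, \<open>k\<^sub>1\<^sup>2 + k\<^sub>2\<^sup>2 = 1\<close>, and \<open>d \<le> 3\<close> because the curvatures of a Frenet curve are positive.
  Conversely these conditions make every coefficient zero. Harmonicity means \<open>d = 1\<close>.

  The restriction on \<open>n\<close> comes from linear algebra. Differentiating \<open>\<tau>\<^sub>1\<^sub>2 = 0\<close> gives
  \<open>k\<^sub>2 \<tau>\<^sub>1\<^sub>3 = 0\<close>, and for \<open>d = 3\<close> differentiating \<open>\<tau>\<^sub>1\<^sub>3 = 0\<close> gives \<open>k\<^sub>1 \<tau>\<^sub>2\<^sub>3 = 0\<close>
  (\<open>torsion_derivatives\<close>). So for \<open>d \<le> 3\<close> the frame spans a totally real subspace; the horizontal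
  lifts of its vectors at a point of the sphere, together with the point itself, form a Hermitian
  orthogonal system of \<open>d + 1\<close> vectors, whence \<open>d \<le> n\<close> (\<open>dim_bound\<close>).
\<close>

section \<open>Symmetry of second derivatives\<close>

text \<open>
  Applying the mean value theorem first in the direction \<open>u\<close> and then in the direction \<open>v\<close> turns the
  second difference, which is symmetric in \<open>u\<close> and \<open>v\<close>, into a value of one mixed derivative.
\<close>

lemma second_difference_mvt:
  fixes f :: "'a::real_normed_vector \<Rightarrow> real"
  assumes f: "\<And>q. q \<in> ball p r \<Longrightarrow> (f has_derivative f' q) (at q)"
    and f'': "\<And>q. q \<in> ball p r \<Longrightarrow> ((\<lambda>q. f' q u) has_derivative f'' q) (at q)"
    and s: "0 < s" "s * (norm u + norm v) < r"
  obtains q where "dist q p \<le> s * (norm u + norm v)"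
    "f (p + s *\<^sub>R u + s *\<^sub>R v) - f (p + s *\<^sub>R u) - f (p + s *\<^sub>R v) + f p = s * s * f'' q v"
proof -
  have near: "dist (p + a *\<^sub>R u + b *\<^sub>R v) p \<le> s * (norm u + norm v)"
    if "0 \<le> a" "a \<le> s" "0 \<le> b" "b \<le> s" for a b
  proof -
    have "norm (a *\<^sub>R u + b *\<^sub>R v) \<le> a * norm u + b * norm v"
      using norm_triangle_ineq [of "a *\<^sub>R u" "b *\<^sub>R v"] that by simp
    also have "\<dots> \<le> s * norm u + s * norm v"
      by (intro add_mono mult_right_mono) (use that in auto)
    finally show ?thesis by (simp add: dist_norm algebra_simps)
  qed
  have in_ball: "p + a *\<^sub>R u + b *\<^sub>R v \<in> ball p r"
    if "0 \<le> a" "a \<le> s" "0 \<le> b" "b \<le> s" for a b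
    using near [OF that] s(2) by (simp add: dist_commute)
  define g where "g a = f (p + a *\<^sub>R u + s *\<^sub>R v) - f (p + a *\<^sub>R u + 0 *\<^sub>R v)" for a
  have along_u: "((\<lambda>a. f (p + a *\<^sub>R u + b *\<^sub>R v)) has_field_derivative f' (p + a *\<^sub>R u + b *\<^sub>R v) u) (at a)"
    if "0 \<le> a" "a \<le> s" "0 \<le> b" "b \<le> s" for a b
  proof -
    let ?q = "p + a *\<^sub>R u + b *\<^sub>R v"
    have "((\<lambda>a. p + a *\<^sub>R u + b *\<^sub>R v) has_derivative (\<lambda>h. h *\<^sub>R u)) (at a)"
      by (auto intro!: derivative_eq_intros)
    from has_derivative_compose [OF this f [OF in_ball [OF that]]]
    show ?thesis
      using linear_cmul [OF has_derivative_linear [OF f [OF in_ball [OF that]]]]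
      by (simp add: has_field_derivative_def mult_commute_abs o_def)
  qed
  have along_v: "((\<lambda>b. f' (p + a *\<^sub>R u + b *\<^sub>R v) u) has_field_derivative f'' (p + a *\<^sub>R u + b *\<^sub>R v) v) (at b)"
    if "0 \<le> a" "a \<le> s" "0 \<le> b" "b \<le> s" for a b
  proof -
    have "((\<lambda>b. p + a *\<^sub>R u + b *\<^sub>R v) has_derivative (\<lambda>h. h *\<^sub>R v)) (at b)"
      by (auto intro!: derivative_eq_intros)
    from has_derivative_compose [OF this f'' [OF in_ball [OF that]]]
    show ?thesis
      using linear_cmul [OF has_derivative_linear [OF f'' [OF in_ball [OF that]]]]
      by (simp add: has_field_derivative_def mult_commute_abs o_def)
  qed
  have "\<exists>a. 0 < a \<and> a < s \<and> g s - g 0 =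
      (s - 0) * (f' (p + a *\<^sub>R u + s *\<^sub>R v) u - f' (p + a *\<^sub>R u + 0 *\<^sub>R v) u)"
    unfolding g_def using s(1)
    by (intro MVT2 [of 0 s] DERIV_diff along_u) auto
  then obtain a where a: "0 < a" "a < s"
    "g s - g 0 = s * (f' (p + a *\<^sub>R u + s *\<^sub>R v) u - f' (p + a *\<^sub>R u + 0 *\<^sub>R v) u)"
    by auto
  have "\<exists>b. 0 < b \<and> b < s \<and> f' (p + a *\<^sub>R u + s *\<^sub>R v) u - f' (p + a *\<^sub>R u + 0 *\<^sub>R v) u =
      (s - 0) * f'' (p + a *\<^sub>R u + b *\<^sub>R v) v"
    using s(1) a by (intro MVT2 [of 0 s] along_v) auto
  then obtain b where b: "0 < b" "b < s"
    "f' (p + a *\<^sub>R u + s *\<^sub>R v) u - f' (p + a *\<^sub>R u + 0 *\<^sub>R v) u = s * f'' (p + a *\<^sub>R u + b *\<^sub>R v) v"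
    by auto
  show ?thesis
  proof
    show "dist (p + a *\<^sub>R u + b *\<^sub>R v) p \<le> s * (norm u + norm v)"
      using near a b by simp
    show "f (p + s *\<^sub>R u + s *\<^sub>R v) - f (p + s *\<^sub>R u) - f (p + s *\<^sub>R v) + f p =
        s * s * f'' (p + a *\<^sub>R u + b *\<^sub>R v) v"
      using a(3) unfolding b(3) by (simp add: g_def)
  qed
qed

text \<open>
  Both mixed derivatives take the value of the same difference quotient at points close to \<open>p\<close>, so by
  continuity they agree at \<open>p\<close>.
\<close>

lemma second_derivative_symmetric_real:
  fixes f :: "'a::real_normed_vector \<Rightarrow> real"
  assumes U: "open U" "p \<in> U"
    and f: "\<And>q. q \<in> U \<Longrightarrow> (f has_derivative f' q) (at q)"
    and fu: "\<And>q. q \<in> U \<Longrightarrow> ((\<lambda>q. f' q u) has_derivative fu q) (at q)"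
    and fv: "\<And>q. q \<in> U \<Longrightarrow> ((\<lambda>q. f' q v) has_derivative fv q) (at q)"
    and cont: "continuous_on U (\<lambda>q. fu q v)" "continuous_on U (\<lambda>q. fv q u)"
  shows "fu p v = fv p u"
proof (rule ccontr)
  assume neq: "fu p v \<noteq> fv p u"
  define e where "e = \<bar>fu p v - fv p u\<bar> / 2"
  have "e > 0" using neq by (simp add: e_def)
  obtain r where r: "r > 0" "ball p r \<subseteq> U"
    using U open_contains_ball by blast
  have "isCont (\<lambda>q. fu q v) p" "isCont (\<lambda>q. fv q u) p"
    using cont U by (simp_all add: continuous_on_eq_continuous_at)
  then obtain d1 d2 where d: "d1 > 0" "d2 > 0"
    "\<And>q. dist q p < d1 \<Longrightarrow> dist (fu q v) (fu p v) < e"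
    "\<And>q. dist q p < d2 \<Longrightarrow> dist (fv q u) (fv p u) < e"
    using \<open>e > 0\<close> unfolding continuous_at_eps_delta by metis
  define m where "m = min r (min d1 d2)"
  \<comment> \<open>The added \<open>1\<close> keeps the denominator positive when \<open>u\<close> and \<open>v\<close> vanish.\<close>
  define s where "s = m / (2 * (norm u + norm v + 1))"
  have "m > 0" using r d by (simp add: m_def)
  have w: "norm u + norm v + 1 > 0"
    by (smt (verit) norm_ge_zero)
  then have s: "s > 0"
    using \<open>m > 0\<close> by (simp add: s_def)
  have "s * (norm u + norm v) \<le> s * (norm u + norm v + 1)"
    using s by simp
  also have "\<dots> = m / 2"
    using w by (simp add: s_def field_simps)
  also have "\<dots> < m"
    using \<open>m > 0\<close> by simp
  finally have sm: "s * (norm u + norm v) < m" .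
  then have sr: "s * (norm u + norm v) < r" "s * (norm v + norm u) < r"
    by (auto simp: m_def add.commute)
  obtain q1 where q1: "dist q1 p \<le> s * (norm u + norm v)"
    "f (p + s *\<^sub>R u + s *\<^sub>R v) - f (p + s *\<^sub>R u) - f (p + s *\<^sub>R v) + f p = s * s * fu q1 v"
    using second_difference_mvt [of p r f f' u fu s v] f fu r(2) s sr by (metis subsetD)
  obtain q2 where q2: "dist q2 p \<le> s * (norm v + norm u)"
    "f (p + s *\<^sub>R v + s *\<^sub>R u) - f (p + s *\<^sub>R v) - f (p + s *\<^sub>R u) + f p = s * s * fv q2 u"
    using second_difference_mvt [of p r f f' v fv s u] f fv r(2) s sr by (metis subsetD)
  have "s * s * fu q1 v = s * s * fv q2 u"
    using q1(2) q2(2) by (simp add: algebra_simps)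
  then have "fu q1 v = fv q2 u" using s by simp
  moreover have "dist (fu q1 v) (fu p v) < e" "dist (fv q2 u) (fv p u) < e"
    using q1(1) q2(1) sm by (auto simp: m_def add.commute intro!: d(3,4))
  ultimately show False
    unfolding e_def dist_real_def by (simp add: abs_if split: if_splits)
qed

lemma C2_has_derivative:
  assumes "open U" "Ck_on 2 U F" "q \<in> U"
  shows "(F has_derivative frechet_derivative F (at q)) (at q)"
    "((\<lambda>q. frechet_derivative F (at q) v) has_derivative
      frechet_derivative (\<lambda>q. frechet_derivative F (at q) v) (at q)) (at q)"
    "continuous_on U (\<lambda>q. frechet_derivative (\<lambda>q. frechet_derivative F (at q) v) (at q) u)"
proof -
  have "Ck_on (Suc 1) U F" using assms(2) by (simp only: numeral_2_eq_2 One_nat_def)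
  then have F: "F differentiable_on U" "\<And>v. Ck_on 1 U (\<lambda>x. frechet_derivative F (at x within U) v)"
    by simp_all
  have "Ck_on 1 U (\<lambda>x. frechet_derivative F (at x) v)"
    using F(2) [of v] by (subst Ck_on_cong) (auto simp: at_within_open [OF _ assms(1)])
  then have F': "(\<lambda>x. frechet_derivative F (at x) v) differentiable_on U"
    "continuous_on U (\<lambda>x. frechet_derivative (\<lambda>x. frechet_derivative F (at x) v) (at x within U) u)"
    by simp_all
  show "(F has_derivative frechet_derivative F (at q)) (at q)"
    "((\<lambda>q. frechet_derivative F (at q) v) has_derivative
      frechet_derivative (\<lambda>q. frechet_derivative F (at q) v) (at q)) (at q)"
    using F(1) F'(1) assms by (metis at_within_open differentiable_on_def frechet_derivative_works)+
  show "continuous_on U (\<lambda>q. frechet_derivative (\<lambda>q. frechet_derivative F (at q) v) (at q) u)"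
    using F'(2) by (rule continuous_on_cong [THEN iffD1, rotated 2])
      (auto simp: at_within_open [OF _ assms(1)])
qed

lemma second_derivative_symmetric:
  fixes F :: "'a::real_normed_vector \<Rightarrow> 'b::real_inner"
  assumes U: "open U" "p \<in> U" and F: "Ck_on 2 U F"
  shows "frechet_derivative (\<lambda>q. frechet_derivative F (at q) u) (at p) v =
    frechet_derivative (\<lambda>q. frechet_derivative F (at q) v) (at p) u"
proof -
  note D = C2_has_derivative(1,2) [OF U(1) F] and cont = C2_has_derivative(3) [OF U(1) F U(2)]
  have "frechet_derivative (\<lambda>q. frechet_derivative F (at q) u) (at p) v \<bullet> b =
    frechet_derivative (\<lambda>q. frechet_derivative F (at q) v) (at p) u \<bullet> b" for b
    by (rule second_derivative_symmetric_real [OF U, of "\<lambda>q. F q \<bullet> b"])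
      (auto intro!: has_derivative_inner_left D continuous_on_inner continuous_on_const cont)
  then show ?thesis
    using vector_eq_ldot by (metis inner_commute)
qed

text \<open>
  A product rule for \<open>q \<mapsto> DF\<^sub>q(G q)\<close>. Since differentiability of \<open>DF\<close> is known only for each fixed
  direction, \<open>G q\<close> is expanded in the standard basis.
\<close>

lemma derivative_apply_has_derivative:
  fixes F :: "'a::euclidean_space \<Rightarrow> 'b::real_normed_vector"
  assumes U: "open U" "p \<in> U" and F: "Ck_on 2 U F"
    and G: "(G has_derivative G') (at p)"
  shows "((\<lambda>q. frechet_derivative F (at q) (G q)) has_derivative
    (\<lambda>h. frechet_derivative (\<lambda>q. frechet_derivative F (at q) (G p)) (at p) h +
      frechet_derivative F (at p) (G' h))) (at p)"
proof -
  note D = C2_has_derivative(1,2) [OF U(1) F]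
  have expand: "frechet_derivative F (at q) v = (\<Sum>b\<in>Basis. (v \<bullet> b) *\<^sub>R frechet_derivative F (at q) b)"
    if "q \<in> U" for q v
  proof -
    have lin: "linear (frechet_derivative F (at q))"
      using D(1) [OF that] has_derivative_linear by blast
    have "frechet_derivative F (at q) v = frechet_derivative F (at q) (\<Sum>b\<in>Basis. (v \<bullet> b) *\<^sub>R b)"
      by (simp add: euclidean_representation)
    then show ?thesis
      by (simp add: linear_sum [OF lin] linear_cmul [OF lin])
  qed
  have product: "((\<lambda>q. frechet_derivative F (at q) (G q)) has_derivative
    (\<lambda>h. \<Sum>b\<in>Basis. (G p \<bullet> b) *\<^sub>R frechet_derivative (\<lambda>q. frechet_derivative F (at q) b) (at p) h +
       (G' h \<bullet> b) *\<^sub>R frechet_derivative F (at p) b)) (at p)"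
    if "(G has_derivative G') (at p)" for G :: "'a \<Rightarrow> 'a" and G'
  proof (rule has_derivative_transform_within_open [OF _ U])
    show "((\<lambda>q. \<Sum>b\<in>Basis. (G q \<bullet> b) *\<^sub>R frechet_derivative F (at q) b) has_derivative
      (\<lambda>h. \<Sum>b\<in>Basis. (G p \<bullet> b) *\<^sub>R frechet_derivative (\<lambda>q. frechet_derivative F (at q) b) (at p) h +
       (G' h \<bullet> b) *\<^sub>R frechet_derivative F (at p) b)) (at p)"
      by (intro has_derivative_sum has_derivative_scaleR has_derivative_inner_left that D(2) U(2))
  qed (rule expand [symmetric])
  \<comment> \<open>The constant field \<open>v\<close> shows that the second derivative is linear in its first direction.\<close>
  have const: "frechet_derivative (\<lambda>q. frechet_derivative F (at q) v) (at p) h =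
      (\<Sum>b\<in>Basis. (v \<bullet> b) *\<^sub>R frechet_derivative (\<lambda>q. frechet_derivative F (at q) b) (at p) h)" for v h
    using frechet_derivative_at [OF product [of "\<lambda>_. v" "\<lambda>_. 0"]]
    by (simp add: fun_eq_iff)
  show ?thesis
    using product [OF G] unfolding const [of "G p"] expand [OF U(2), of "G' _"]
    by (simp only: sum.distrib)
qed


section \<open>Derivatives along a submanifold through extensions\<close>

text \<open>
  Derivatives along a submanifold can be computed from any extension to an open set that is
  differentiable at the point, because a curve through the point stays in the open set for small
  parameters.
\<close>

lemma extension_has_vector_derivative:
  assumes U: "open U" "p \<in> U" and F: "(F has_derivative L) (at p)"
    and ext: "\<And>q. q \<in> U \<inter> M \<Longrightarrow> F q = f q" and c: "curve_through M p v c"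
  shows "((f \<circ> c) has_vector_derivative L v) (at 0)"
proof -
  have dc: "c 0 = p" "(c has_vector_derivative v) (at 0)"
    using c by (auto simp: curve_through_def)
  have FL: "((F \<circ> c) has_vector_derivative L v) (at 0)"
    using vector_derivative_diff_chain_within [of c v 0 UNIV F L] F dc
    by (simp add: has_derivative_at_withinI)
  have "isCont c 0" using dc(2) has_vector_derivative_continuous by blast
  then have "(c \<longlongrightarrow> c 0) (nhds 0)"
    by (simp add: isCont_def tendsto_at_iff_tendsto_nhds)
  then have "\<forall>\<^sub>F s in nhds 0. c s \<in> U"
    by (rule topological_tendstoD) (use U dc(1) in auto)
  then have "\<forall>\<^sub>F s in nhds 0. (F \<circ> c) s = (f \<circ> c) s"
    using curve_eventually_in [OF c] by eventually_elim (use ext in auto)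
  then show ?thesis
    using FL unfolding has_vector_derivative_def
    by (rule_tac has_derivative_transform_eventually [where f = "F \<circ> c"])
      (auto dest: eventually_nhds_x_imp_x simp: eventually_at_filter elim: eventually_mono)
qed

lemma deriv_along_extension:
  assumes "open U" "p \<in> U" "(F has_derivative L) (at p)"
    and "\<And>q. q \<in> U \<inter> M \<Longrightarrow> F q = f q" and "v \<in> tangent_space M p"
  shows "deriv_along M f p v = L v"
  using assms by (intro deriv_alongI extension_has_vector_derivative [of U p F]) auto

lemma smooth_vector_field_extension:
  assumes "smooth_vector_field M X" "p \<in> M"
  obtains U F where "open U" "p \<in> U" "Ck_on 2 U F" "\<And>q. q \<in> U \<inter> M \<Longrightarrow> F q = X q"
  using assms unfolding smooth_vector_field_def smooth_on_def by metis


section \<open>Matrix algebra at a projector\<close>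

interpretation matrix_mult: bounded_bilinear "(**) :: complex^'m::finite^'m \<Rightarrow> complex^'m^'m \<Rightarrow> complex^'m^'m"
  by (rule bounded_bilinear_matrix_mult)

lemmas linear_adjoint_mat = bounded_linear.linear [OF bounded_linear_adjoint_mat]

lemmas matrix_expand = matrix_mult.add_left matrix_mult.add_right matrix_mult.diff_left
  matrix_mult.diff_right matrix_mult.minus_left matrix_mult.minus_right matrix_mult.zero_left
  matrix_mult.zero_right matrix_mult.scaleR_left matrix_mult.scaleR_right matrix_mul_assoc

lemma adjoint_mult: "adjoint_mat (A ** B) = adjoint_mat B ** adjoint_mat A"
  by (simp add: adjoint_mat_def matrix_matrix_mult_def vec_eq_iff mult.commute)

lemma inner_adjoint: "adjoint_mat A \<bullet> adjoint_mat B = A \<bullet> B"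
proof -
  have "adjoint_mat A \<bullet> adjoint_mat B = (\<Sum>i\<in>UNIV. \<Sum>j\<in>UNIV. A $ j $ i \<bullet> B $ j $ i)"
    by (simp add: inner_vec_def adjoint_mat_def inner_complex_def)
  also have "\<dots> = A \<bullet> B"
    unfolding inner_vec_def by (rule sum.swap)
  finally show ?thesis .
qed

lemma inner_mult_left:
  fixes A B P :: "complex^'m::finite^'m"
  shows "(P ** A) \<bullet> B = A \<bullet> (adjoint_mat P ** B)"
proof -
  have inner_Re: "a \<bullet> b = Re (a * cnj b)" for a b :: complex
    by (simp add: inner_complex_def)
  have "(P ** A) \<bullet> B = Re (\<Sum>i\<in>UNIV. \<Sum>j\<in>UNIV. \<Sum>k\<in>UNIV. P $ i $ k * A $ k $ j * cnj (B $ i $ j))"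
    by (simp add: inner_vec_def matrix_matrix_mult_def inner_Re sum_distrib_right)
  also have "(\<Sum>i\<in>UNIV. \<Sum>j\<in>UNIV. \<Sum>k\<in>UNIV. P $ i $ k * A $ k $ j * cnj (B $ i $ j)) =
      (\<Sum>i\<in>UNIV. \<Sum>k\<in>UNIV. \<Sum>j\<in>UNIV. P $ i $ k * A $ k $ j * cnj (B $ i $ j))"
    by (intro sum.cong refl sum.swap)
  also have "\<dots> = (\<Sum>k\<in>UNIV. \<Sum>i\<in>UNIV. \<Sum>j\<in>UNIV. P $ i $ k * A $ k $ j * cnj (B $ i $ j))"
    by (rule sum.swap)
  also have "\<dots> = (\<Sum>k\<in>UNIV. \<Sum>j\<in>UNIV. \<Sum>i\<in>UNIV. P $ i $ k * A $ k $ j * cnj (B $ i $ j))"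
    by (intro sum.cong refl sum.swap)
  also have "Re \<dots> = A \<bullet> (adjoint_mat P ** B)"
    by (simp add: inner_vec_def matrix_matrix_mult_def inner_Re adjoint_mat_def sum_distrib_left
        algebra_simps)
  finally show ?thesis .
qed

lemma inner_mult_right:
  fixes A B P :: "complex^'m::finite^'m"
  shows "(A ** P) \<bullet> B = A \<bullet> (B ** adjoint_mat P)"
proof -
  have "(A ** P) \<bullet> B = (adjoint_mat P ** adjoint_mat A) \<bullet> adjoint_mat B"
    by (simp add: inner_adjoint flip: adjoint_mult)
  also have "\<dots> = adjoint_mat A \<bullet> adjoint_mat (B ** adjoint_mat P)"
    by (simp add: inner_mult_left adjoint_mult)
  finally show ?thesis
    by (simp only: inner_adjoint)
qed

lemma tangent_CP:
  fixes A P X :: "complex^'m::finite^'m"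
  assumes "P \<in> CP" "X \<in> tangent_space CP P"
  shows "adjoint_mat X = X" "X ** P = X - P ** X" "A ** X ** P = A ** X - A ** P ** X"
proof -
  have *: "adjoint_mat X = X" "X ** P + P ** X = X"
    using assms tangent_space_CP_eq by auto
  then show "adjoint_mat X = X" "X ** P = X - P ** X"
    by (simp_all add: eq_diff_eq)
  then show "A ** X ** P = A ** X - A ** P ** X"
    by (simp only: matrix_mult.diff_right flip: matrix_mul_assoc)
qed

text \<open>
  This, \<open>tangent_CP\<close> and \<open>matrix_expand\<close> form a terminating rewrite system on left associated
  products: powers of \<open>P\<close> collapse and a \<open>P\<close> to the right of a tangent matrix moves to its left.
  Most matrix identities below are proved by it.
\<close>

lemma idem_assoc: "P ** P = P \<Longrightarrow> A ** P ** P = A ** P"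
  by (simp flip: matrix_mul_assoc)

text \<open>
  The orthogonal projection of Hermitian matrices onto the tangent space at \<open>P\<close>; it keeps the blocks
  of a matrix that map the range of \<open>P\<close> to its kernel and vice versa. The term \<open>P A P\<close> is
  added to itself instead of scaled by \<open>2\<close> so that rewriting deals with sums of products only.
\<close>

definition tangent_proj :: "complex^'m::finite^'m \<Rightarrow> complex^'m^'m \<Rightarrow> complex^'m^'m" where
  "tangent_proj P A = P ** A + A ** P - (P ** A ** P + P ** A ** P)"

lemma linear_tangent_proj: "linear (tangent_proj P)"
  by (rule linearI) (simp_all only: tangent_proj_def matrix_expand scaleR_add_right scaleR_diff_right,
      simp_all add: algebra_simps)

lemma tangent_proj_idem:
  assumes "P \<in> CP" shows "tangent_proj P (tangent_proj P A) = tangent_proj P A"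
  by (simp only: tangent_proj_def matrix_expand CP_idem [OF assms] idem_assoc [OF CP_idem [OF assms]])
    (simp add: algebra_simps)

lemma tangent_proj_tangent:
  assumes "P \<in> CP" "X \<in> tangent_space CP P" shows "tangent_proj P X = X"
  by (simp only: tangent_proj_def matrix_expand CP_idem [OF assms(1)] idem_assoc [OF CP_idem [OF assms(1)]]
      tangent_CP(2,3) [OF assms])
    (simp add: algebra_simps)

lemma tangent_proj_mem:
  assumes "P \<in> CP" "adjoint_mat A = A" shows "tangent_proj P A \<in> tangent_space CP P"
proof -
  have "adjoint_mat (tangent_proj P A) = tangent_proj P A"
    by (simp only: tangent_proj_def linear_add [OF linear_adjoint_mat] linear_diff [OF linear_adjoint_mat]
        adjoint_mult CP_adjoint [OF assms(1)] assms(2) matrix_mul_assoc add.commute)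
  moreover have "tangent_proj P A ** P + P ** tangent_proj P A = tangent_proj P A"
    by (simp only: tangent_proj_def matrix_expand CP_idem [OF assms(1)]
        idem_assoc [OF CP_idem [OF assms(1)]])
      (simp add: algebra_simps)
  ultimately show ?thesis
    by (simp add: tangent_space_CP_eq [OF assms(1)])
qed

lemma tangent_part_CP:
  assumes P: "P \<in> CP" and A: "adjoint_mat A = A"
  shows "tangent_part CP P A = tangent_proj P A"
proof (rule tangent_part_unique [OF subspace_tangent_space_CP [OF P] tangent_proj_mem [OF P A]])
  fix X assume X: "X \<in> tangent_space CP P"
  have "(P ** A ** P) \<bullet> X = A \<bullet> (P ** X ** P)"
    by (simp only: inner_mult_right [of "P ** A"] inner_mult_left [of P A] CP_adjoint [OF P] matrix_mul_assoc)
  also have "P ** X ** P = 0"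
    using tangent_CP(3) [OF P X, of P] CP_idem [OF P] by simp
  finally have "tangent_proj P A \<bullet> X = A \<bullet> (P ** X) + A \<bullet> (X ** P)"
    by (simp only: tangent_proj_def inner_add_left inner_diff_left inner_mult_left [of P A]
        inner_mult_right [of A P] CP_adjoint [OF P] inner_zero_right add_0_right diff_zero)
  then show "tangent_proj P A \<bullet> X = A \<bullet> X"
    by (simp add: tangent_CP(2) [OF P X] inner_diff_right)
qed

lemma tangent_proj_has_derivative:
  assumes H: "(H has_derivative H') (at P)"
  shows "((\<lambda>q. tangent_proj q (H q)) has_derivative
    (\<lambda>h. h ** H P + H P ** h - ((h ** H P ** P + P ** H P ** h) + (h ** H P ** P + P ** H P ** h)) + tangent_proj P (H' h))) (at P)"
proof -
  have *: "(\<lambda>q. tangent_proj q (H q)) = (\<lambda>q. q ** H q + H q ** q - (q ** H q ** q + q ** H q ** q))"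
    by (simp add: tangent_proj_def fun_eq_iff)
  show ?thesis
    unfolding *
    by (rule has_derivative_eq_rhs,
        (rule has_derivative_diff has_derivative_add matrix_mult.FDERIV
          has_derivative_ident H)+)
      (simp add: fun_eq_iff tangent_proj_def matrix_expand algebra_simps)
qed

text \<open>
  With \<open>A = D\<^sub>y Z\<close>, the hypothesis on \<open>A\<close> is the derivative of the tangency condition \<open>Z P + P Z = Z\<close> in
  the direction \<open>y\<close>, and the argument of \<open>tangent_proj\<close> is the derivative of \<open>q \<mapsto> tangent_proj q A\<close>
  in the direction \<open>x\<close>. The derivative of \<open>Z\<close> drops out because the projected matrix involves
  only the diagonal blocks of \<open>A\<close>, and the condition expresses these through \<open>y\<close> and \<open>z\<close>.
\<close>

lemma curvature_algebra:
  assumes P: "P \<in> CP" and xyz: "x \<in> tangent_space CP P" "y \<in> tangent_space CP P" "z \<in> tangent_space CP P"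
    and A: "A = A ** P + P ** A + (y ** z + z ** y)"
  shows "tangent_proj P (x ** A + A ** x - ((x ** A ** P + P ** A ** x) + (x ** A ** P + P ** A ** x))) =
    x ** (y ** z + z ** y) + (y ** z + z ** y) ** x"
proof -
  have AP: "A ** P = A - P ** A - (y ** z + z ** y)"
    using A by (simp add: algebra_simps)
  have CAP: "C ** A ** P = C ** A - C ** P ** A - (C ** y ** z + C ** z ** y)" for C :: "complex^'a^'a"
    using arg_cong [OF AP, of "(**) C"] by (simp only: matrix_expand)
  show ?thesis
    by (simp only: tangent_proj_def matrix_expand AP CAP CP_idem [OF P] idem_assoc [OF CP_idem [OF P]]
        tangent_CP(2,3) [OF P xyz(1)] tangent_CP(2,3) [OF P xyz(2)] tangent_CP(2,3) [OF P xyz(3)])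
      (simp add: algebra_simps)
qed


section \<open>Curvature of complex projective space\<close>

lemma adjoint_extension_derivative:
  assumes U: "open U" "P \<in> U" and F: "(F has_derivative L) (at P)"
    and ext: "\<And>q. q \<in> U \<inter> CP \<Longrightarrow> F q = f q" and adj: "\<And>q. q \<in> CP \<Longrightarrow> adjoint_mat (f q) = f q"
    and v: "v \<in> tangent_space CP P"
  shows "adjoint_mat (L v) = L v"
proof -
  obtain c where c: "curve_through CP P v c"
    using v by (auto simp: tangent_space_def)
  show ?thesis
    by (rule deriv_adjoint [OF c extension_has_vector_derivative [OF U F ext c]]) (simp_all add: adj)
qed

lemma smooth_vector_field_CP:
  assumes "smooth_vector_field CP X" "P \<in> CP"
  shows "X P \<in> tangent_space CP P" "adjoint_mat (X P) = X P"
  using assms tangent_CP(1) by (auto simp: smooth_vector_field_def)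

text \<open>
  Near \<open>P\<close> the field \<open>\<nabla>\<^sub>Y Z\<close> is \<open>q \<mapsto> tangent_proj q (DF\<^sub>q(Y q))\<close> for an extension \<open>F\<close> of \<open>Z\<close>. Its
  derivative has one part from the moving projection, evaluated by \<open>curvature_algebra\<close>, and one from
  the flat connection. Keeping the latter in terms of \<open>F\<close> lets it cancel in the curvature.
\<close>

lemma nabla_CP_iterated:
  assumes X: "smooth_vector_field CP X" and Y: "smooth_vector_field CP Y" and Z: "smooth_vector_field CP Z"
    and P: "P \<in> CP"
    and F: "open U" "P \<in> U" "Ck_on 2 U F" "\<And>q. q \<in> U \<inter> CP \<Longrightarrow> F q = Z q"
  shows "nabla CP X (nabla CP Y Z) P =
    X P ** (Y P ** Z P + Z P ** Y P) + (Y P ** Z P + Z P ** Y P) ** X P +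
    tangent_proj P (frechet_derivative (\<lambda>q. frechet_derivative F (at q) (Y P)) (at P) (X P) +
      frechet_derivative F (at P) (deriv_along CP Y P (X P)))"
proof -
  note tan = smooth_vector_field_CP(1) [OF X P] smooth_vector_field_CP(1) [OF Y P]
    smooth_vector_field_CP(1) [OF Z P]
  note F' = C2_has_derivative(1) [OF F(1,3)]
  obtain V G where V: "open V" "P \<in> V" "Ck_on 2 V G" and G: "\<And>q. q \<in> V \<inter> CP \<Longrightarrow> G q = Y q"
    using smooth_vector_field_extension [OF Y P] by metis
  note G' = C2_has_derivative(1) [OF V(1,3,2)]
  have GP: "G P = Y P" using G P V(2) by simp
  have UV: "open (U \<inter> V)" "P \<in> U \<inter> V" using F V by auto
  have dZ: "deriv_along CP Z q v = frechet_derivative F (at q) v"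
    if "q \<in> U \<inter> CP" "v \<in> tangent_space CP q" for q v
    using that deriv_along_extension [OF F(1) _ F' F(4)] by blast
  have dZ_adj: "adjoint_mat (frechet_derivative F (at q) v) = frechet_derivative F (at q) v"
    if "q \<in> U \<inter> CP" "v \<in> tangent_space CP q" for q v
    using that adjoint_extension_derivative [OF F(1) _ F' F(4) smooth_vector_field_CP(2) [OF Z]] by blast
  define H where "H = (\<lambda>q. tangent_proj q (frechet_derivative F (at q) (G q)))"
  define A where "A = frechet_derivative F (at P) (Y P)"
  define B where "B = frechet_derivative (\<lambda>q. frechet_derivative F (at q) (Y P)) (at P) (X P) +
      frechet_derivative F (at P) (deriv_along CP Y P (X P))"
  have dY: "frechet_derivative G (at P) (X P) = deriv_along CP Y P (X P)"
    using deriv_along_extension [OF V(1,2) G' G tan(1)] by simp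
  have H: "H q = nabla CP Y Z q" "adjoint_mat (nabla CP Y Z q) = nabla CP Y Z q"
    if "q \<in> U \<inter> V \<inter> CP" for q
  proof -
    have Yq: "Y q \<in> tangent_space CP q" "q \<in> CP"
      using smooth_vector_field_CP(1) [OF Y] that by auto
    show "H q = nabla CP Y Z q"
      using that Yq by (simp add: H_def nabla_def G dZ tangent_part_CP dZ_adj)
    show "adjoint_mat (nabla CP Y Z q) = nabla CP Y Z q"
      unfolding nabla_def
      using tangent_CP(1) tangent_part_mem subspace_tangent_space_CP Yq(2) by metis
  qed
  define H' where "H' = (\<lambda>h. h ** A + A ** h - ((h ** A ** P + P ** A ** h) + (h ** A ** P + P ** A ** h)) +
      tangent_proj P (frechet_derivative (\<lambda>q. frechet_derivative F (at q) (Y P)) (at P) h +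
      frechet_derivative F (at P) (frechet_derivative G (at P) h)))"
  have dH: "(H has_derivative H') (at P)"
    using tangent_proj_has_derivative [OF derivative_apply_has_derivative [OF F(1,2,3) G']]
    by (simp add: H_def H'_def A_def GP)
  have "deriv_along CP (nabla CP Y Z) P (X P) = H' (X P)"
    by (rule deriv_along_extension [OF UV dH _ tan(1)]) (simp add: H)
  moreover have "adjoint_mat (H' (X P)) = H' (X P)"
  proof -
    obtain c where c: "curve_through CP P (X P) c"
      using tan(1) by (auto simp: tangent_space_def)
    have "adjoint_mat (nabla CP Y Z q) = nabla CP Y Z q" if "q \<in> CP" for q
      unfolding nabla_def
      using tangent_CP(1) tangent_part_mem subspace_tangent_space_CP that by metis
    then show ?thesis
      by (intro adjoint_extension_derivative [OF UV dH _ _ tan(1), of "nabla CP Y Z"]) (simp_all add: H)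
  qed
  ultimately have nabla: "nabla CP X (nabla CP Y Z) P = tangent_proj P (H' (X P))"
    by (simp add: nabla_def [of CP X "nabla CP Y Z"] tangent_part_CP [OF P])
  \<comment> \<open>Differentiating \<open>Z q ** q + q ** Z q = Z q\<close> in the direction of \<open>Y\<close>.\<close>
  obtain c where c: "curve_through CP P (Y P) c"
    using tan(2) by (auto simp: tangent_space_def)
  have "((Z \<circ> c) has_vector_derivative A) (at 0)"
    unfolding A_def by (rule extension_has_vector_derivative [OF F(1,2) F' [OF F(2)] F(4) c])
  moreover have "(Z \<circ> c) s ** c s + c s ** (Z \<circ> c) s = (Z \<circ> c) s" if "c s \<in> CP" for s
    using smooth_vector_field_CP(1) [OF Z that] tangent_space_CP_eq [OF that] by simp
  ultimately have "((Z \<circ> c) 0 ** Y P + A ** P) + (P ** A + Y P ** (Z \<circ> c) 0) = A"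
    by (rule deriv_idem [OF c])
  then have "A = A ** P + P ** A + (Y P ** Z P + Z P ** Y P)"
    using c by (simp add: curve_through_def algebra_simps)
  from curvature_algebra [OF P tan this] show ?thesis
    unfolding nabla H'_def dY B_def [symmetric]
    by (simp only: linear_add [OF linear_tangent_proj] tangent_proj_idem [OF P])
qed

text \<open>
  The flat parts of the three terms cancel: the ambient connection is flat, by symmetry of the second
  derivative of \<open>F\<close>.
\<close>

lemma curvature_expression_CP:
  assumes X: "smooth_vector_field CP X" and Y: "smooth_vector_field CP Y" and Z: "smooth_vector_field CP Z"
    and P: "P \<in> CP"
  shows "nabla CP X (nabla CP Y Z) P - nabla CP Y (nabla CP X Z) P - nabla CP (lie_bracket CP X Y) Z P =
    X P ** Y P ** Z P + Z P ** Y P ** X P - Y P ** X P ** Z P - Z P ** X P ** Y P"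
proof -
  obtain U F where F: "open U" "P \<in> U" "Ck_on 2 U F" and FZ: "\<And>q. q \<in> U \<inter> CP \<Longrightarrow> F q = Z q"
    using smooth_vector_field_extension [OF Z P] by metis
  note F' = C2_has_derivative(1) [OF F(1,3,2)]
  note lie = lie_bracket_CP_tangent [OF X Y P]
  have "deriv_along CP Z P (lie_bracket CP X Y P) = frechet_derivative F (at P) (lie_bracket CP X Y P)"
    by (rule deriv_along_extension [OF F(1,2) F' FZ lie])
  moreover have "adjoint_mat (frechet_derivative F (at P) (lie_bracket CP X Y P)) =
      frechet_derivative F (at P) (lie_bracket CP X Y P)"
    by (rule adjoint_extension_derivative [OF F(1,2) F' FZ smooth_vector_field_CP(2) [OF Z] lie])
  ultimately have "nabla CP (lie_bracket CP X Y) Z P =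
      tangent_proj P (frechet_derivative F (at P) (deriv_along CP Y P (X P)) -
        frechet_derivative F (at P) (deriv_along CP X P (Y P)))"
    by (simp add: nabla_def tangent_part_CP [OF P] lie_bracket_def linear_diff has_derivative_linear [OF F'])
  note lie_term = this
  have iterated: "nabla CP X (nabla CP Y Z) P =
      X P ** (Y P ** Z P + Z P ** Y P) + (Y P ** Z P + Z P ** Y P) ** X P +
      tangent_proj P (frechet_derivative (\<lambda>q. frechet_derivative F (at q) (Y P)) (at P) (X P) +
        frechet_derivative F (at P) (deriv_along CP Y P (X P)))"
    "nabla CP Y (nabla CP X Z) P =
      Y P ** (X P ** Z P + Z P ** X P) + (X P ** Z P + Z P ** X P) ** Y P +
      tangent_proj P (frechet_derivative (\<lambda>q. frechet_derivative F (at q) (Y P)) (at P) (X P) +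
        frechet_derivative F (at P) (deriv_along CP X P (Y P)))"
    using nabla_CP_iterated [OF X Y Z P F FZ] nabla_CP_iterated [OF Y X Z P F FZ]
    by (simp_all only: second_derivative_symmetric [OF F(1,2,3), of "X P" "Y P"])
  show ?thesis
    unfolding iterated lie_term linear_add [OF linear_tangent_proj] linear_diff [OF linear_tangent_proj]
      matrix_expand
    by (simp add: algebra_simps)
qed

lemma Ck_on_const: "Ck_on k UNIV (\<lambda>_. c)"
  by (induction k arbitrary: c) simp_all

lemma Ck_on_affine:
  fixes L :: "'a::real_normed_vector \<Rightarrow> 'b::real_normed_vector"
  assumes L: "bounded_linear L" shows "Ck_on k UNIV (\<lambda>x. L x + c)"
proof (cases k)
  case 0
  then show ?thesis
    using continuous_on_add [OF linear_continuous_on [OF L] continuous_on_const] by simp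
next
  case (Suc j)
  have D: "((\<lambda>x. L x + c) has_derivative L) (at x)" for x
    using has_derivative_add [OF bounded_linear_imp_has_derivative [OF L] has_derivative_const] by simp
  then have "frechet_derivative (\<lambda>x. L x + c) (at x) = L" for x
    using frechet_derivative_at by metis
  then show ?thesis
    using D Suc by (auto simp: differentiable_on_def Ck_on_const intro: differentiableI)
qed

text \<open>
  The derivative of a quadratic polynomial is affine.
\<close>

lemma smooth_on_tangent_proj: "smooth_on UNIV (\<lambda>q. tangent_proj q A)"
proof -
  define Q where "Q = (\<lambda>v q. v ** A + A ** v - ((v ** A ** q + q ** A ** v) + (v ** A ** q + q ** A ** v)))"
  have D: "((\<lambda>q. tangent_proj q A) has_derivative (\<lambda>v. Q v q)) (at q)" for q
    using tangent_proj_has_derivative [OF has_derivative_const, of A q]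
    by (simp add: Q_def linear_0 [OF linear_tangent_proj])
  have Q: "bounded_linear (\<lambda>q. Q v q - Q v 0)" for v
  proof -
    have "linear (\<lambda>q. Q v q - Q v 0)"
      by (rule linearI) (simp_all only: Q_def matrix_expand scaleR_add_right scaleR_diff_right,
          simp_all add: algebra_simps)
    then show ?thesis by (simp add: linear_conv_bounded_linear)
  qed
  have "Ck_on k UNIV (\<lambda>q. tangent_proj q A)" for k
  proof (cases k)
    case 0
    have "isCont (\<lambda>q. tangent_proj q A) q" for q
      using D has_derivative_continuous by blast
    then show ?thesis
      using 0 by (simp add: continuous_at_imp_continuous_on)
  next
    case (Suc j)
    have "frechet_derivative (\<lambda>q. tangent_proj q A) (at q) v = Q v q" for v q
      using frechet_derivative_at [OF D] by metis
    moreover have "Ck_on j UNIV (Q v)" for v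
      using Ck_on_affine [OF Q, of j v "Q v 0"] by simp
    moreover have "(\<lambda>q. tangent_proj q A) differentiable at q" for q
      using D by (rule differentiableI)
    ultimately show ?thesis
      using Suc by (simp add: differentiable_on_def)
  qed
  then show ?thesis by (simp add: smooth_on_def)
qed

lemma smooth_vector_field_tangent_proj:
  assumes "adjoint_mat A = A" shows "smooth_vector_field CP (\<lambda>q. tangent_proj q A)"
  unfolding smooth_vector_field_def
  using tangent_proj_mem [OF _ assms] smooth_on_tangent_proj open_UNIV by blast

text \<open>
  The curvature expression of vector fields depends on their values at \<open>P\<close> only, and
  \<open>q \<mapsto> tangent_proj q v\<close> is a vector field that extends \<open>v\<close>.
\<close>

theorem riemann_CP:
  assumes P: "P \<in> CP" and xyz: "x \<in> tangent_space CP P" "y \<in> tangent_space CP P" "z \<in> tangent_space CP P"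
  shows "riemann CP P x y z = x ** y ** z + z ** y ** x - y ** x ** z - z ** x ** y"
  unfolding riemann_def
proof (rule the_equality)
  fix w assume w: "\<forall>X Y Z. smooth_vector_field CP X \<and> smooth_vector_field CP Y \<and> smooth_vector_field CP Z \<and>
      X P = x \<and> Y P = y \<and> Z P = z \<longrightarrow>
      w = nabla CP X (nabla CP Y Z) P - nabla CP Y (nabla CP X Z) P - nabla CP (lie_bracket CP X Y) Z P"
  have field: "smooth_vector_field CP (\<lambda>q. tangent_proj q v)" "tangent_proj P v = v"
    if "v \<in> tangent_space CP P" for v
    using smooth_vector_field_tangent_proj [OF tangent_CP(1) [OF P that]] tangent_proj_tangent [OF P that] .
  then show "w = x ** y ** z + z ** y ** x - y ** x ** z - z ** x ** y"
    using w [rule_format, of "\<lambda>q. tangent_proj q x" "\<lambda>q. tangent_proj q y" "\<lambda>q. tangent_proj q z"] xyz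
      curvature_expression_CP [OF field(1) [OF xyz(1)] field(1) [OF xyz(2)] field(1) [OF xyz(3)] P]
    by simp
qed (auto simp: curvature_expression_CP [OF _ _ _ P])


section \<open>The complex structure and the sectional curvature\<close>

definition imag_mult :: "complex^'m::finite^'m \<Rightarrow> complex^'m^'m" where
  "imag_mult A = (\<chi> i j. \<i> * A $ i $ j)"

lemma linear_imag_mult: "linear imag_mult"
  by (rule linearI) (simp_all add: imag_mult_def vec_eq_iff algebra_simps)

lemma imag_mult_mult:
  fixes A B :: "complex^'m::finite^'m"
  shows "imag_mult A ** B = imag_mult (A ** B)" "A ** imag_mult B = imag_mult (A ** B)"
  by (simp_all add: imag_mult_def matrix_matrix_mult_def vec_eq_iff sum_distrib_left algebra_simps)

lemma inner_imag_mult: "imag_mult A \<bullet> B = - (A \<bullet> imag_mult B)"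
  by (simp add: imag_mult_def inner_vec_def inner_complex_def flip: sum_negf)

lemma cplx_struct_imag_mult: "cplx_struct P X = imag_mult (X ** P - P ** X)"
  by (simp add: cplx_struct_def imag_mult_def)

lemma bounded_bilinear_cplx_struct: "bounded_bilinear (cplx_struct :: complex^'m::finite^'m \<Rightarrow> _)"
  unfolding bilinear_conv_bounded_bilinear [symmetric] bilinear_def cplx_struct_imag_mult
  by (intro conjI allI linearI;
      simp only: matrix_expand linear_add [OF linear_imag_mult] linear_diff [OF linear_imag_mult]
        linear_cmul [OF linear_imag_mult] scaleR_diff_right;
      simp add: algebra_simps)

lemma inner_cplx_struct_skew:
  assumes "adjoint_mat P = P"
  shows "cplx_struct P A \<bullet> B = - (A \<bullet> cplx_struct P B)"
  by (simp add: cplx_struct_imag_mult inner_imag_mult inner_diff_left inner_diff_right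
      inner_mult_left [of P A] inner_mult_right [of A P] assms imag_mult_mult linear_diff [OF linear_imag_mult])

lemma fs_cplx_struct_skew:
  assumes "P \<in> CP"
  shows "fs_metric X (cplx_struct P Y) = - fs_metric Y (cplx_struct P X)"
  using inner_cplx_struct_skew [OF CP_adjoint [OF assms], of X Y]
  by (simp add: fs_metric_def inner_commute)

lemma fs_cplx_struct_self: "P \<in> CP \<Longrightarrow> fs_metric X (cplx_struct P X) = 0"
  using fs_cplx_struct_skew [of P X X] by simp

lemma cplx_struct_tangent:
  assumes P: "P \<in> CP" and X: "X \<in> tangent_space CP P"
  shows "cplx_struct P X \<in> tangent_space CP P"
proof -
  obtain z where z: "norm z = 1" "P = hopf z"
    using P by (auto simp: CP_def)
  then obtain v where v: "cinner v z = 0" "X = hopf_deriv z v"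
    using X tangent_space_hopf [OF z(1)] by auto
  moreover have "cinner (\<i> *s v) z = \<i> * cinner v z"
    by (simp add: cinner_def sum_distrib_left mult.assoc)
  ultimately show ?thesis
    using z cplx_struct_hopf [OF z(1) v(1)] hopf_deriv_tangent [OF z(1), of "\<i> *s v"] by simp
qed

text \<open>
  The commutator of two tangent matrices commutes with \<open>P\<close>, so it is block diagonal and hence orthogonal
  to the tangent space. For this reason the derivative of the complex structure does not contribute to
  the derivative of the complex torsions: \<open>J\<close> is parallel.
\<close>

lemma inner_cplx_struct_tangent_zero:
  assumes P: "P \<in> CP"
    and X: "X \<in> tangent_space CP P" and Y: "Y \<in> tangent_space CP P" and Z: "Z \<in> tangent_space CP P"
  shows "X \<bullet> cplx_struct Y Z = 0"
proof -
  define B where "B = cplx_struct Y Z"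
  have BP: "B ** P = P ** B"
    unfolding B_def cplx_struct_imag_mult imag_mult_mult
    by (simp only: matrix_expand tangent_CP(2,3) [OF P Y] tangent_CP(2,3) [OF P Z]) simp
  have PXP: "P ** X ** P = 0"
    using tangent_CP(3) [OF P X, of P] CP_idem [OF P] by simp
  have "X \<bullet> B = (X ** P) \<bullet> B + (P ** X) \<bullet> B"
    using tangent_CP(2) [OF P X] by (simp add: inner_diff_left)
  also have "(X ** P) \<bullet> B = (P ** X ** P) \<bullet> B"
  proof -
    have "(X ** P) \<bullet> B = X \<bullet> (B ** P ** P)"
      by (simp only: inner_mult_right [of X P] CP_adjoint [OF P] idem_assoc [OF CP_idem [OF P]])
    also have "\<dots> = X \<bullet> (P ** B ** P)"
      by (simp only: BP flip: matrix_mul_assoc)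
    also have "\<dots> = (P ** X ** P) \<bullet> B"
      by (simp only: inner_mult_right [of "P ** X" P] inner_mult_left [of P X] CP_adjoint [OF P]
          matrix_mul_assoc)
    finally show ?thesis .
  qed
  also have "(P ** X) \<bullet> B = (P ** X ** P) \<bullet> B"
  proof -
    have "(P ** X) \<bullet> B = X \<bullet> (P ** P ** B)"
      by (simp only: inner_mult_left [of P X] CP_adjoint [OF P] CP_idem [OF P])
    also have "\<dots> = X \<bullet> (P ** B ** P)"
      by (simp only: BP flip: matrix_mul_assoc)
    also have "\<dots> = (P ** X ** P) \<bullet> B"
      by (simp only: inner_mult_right [of "P ** X" P] inner_mult_left [of P X] CP_adjoint [OF P]
          matrix_mul_assoc)
    finally show ?thesis .
  qed
  finally show ?thesis
    by (simp add: PXP B_def)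
qed

lemma cinner_zero_iff: "cinner v w = 0 \<longleftrightarrow> v \<bullet> w = 0 \<and> v \<bullet> (\<i> *s w) = 0"
proof -
  have "cinner v (\<i> *s w) = - \<i> * cinner v w"
    by (simp add: cinner_def sum_distrib_left algebra_simps flip: sum_negf)
  then show ?thesis
    by (simp add: complex_eq_iff flip: Re_cinner)
qed

lemma cinner_zero_hopf:
  assumes z: "norm z = 1" and v: "cinner v z = 0" and w: "cinner w z = 0"
  shows "cinner v w = 0 \<longleftrightarrow> fs_metric (hopf_deriv z v) (hopf_deriv z w) = 0 \<and>
    fs_metric (hopf_deriv z v) (cplx_struct (hopf z) (hopf_deriv z w)) = 0"
proof -
  have "cinner (\<i> *s w) z = 0"
    using w by (simp add: cinner_def mult.assoc flip: sum_distrib_left)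
  then show ?thesis
    by (simp add: cplx_struct_hopf [OF z w] fs_metric_hopf [OF z v] w cinner_zero_iff)
qed

lemma riemann_CP_totally_real:
  assumes P: "P \<in> CP" and X: "X \<in> tangent_space CP P" and Y: "Y \<in> tangent_space CP P"
    and XX: "fs_metric X X = 1" and XY: "fs_metric X Y = 0" "fs_metric X (cplx_struct P Y) = 0"
  shows "riemann CP P X Y X = - Y"
proof -
  obtain z where z: "norm z = 1" "P = hopf z"
    using P by (auto simp: CP_def)
  obtain v where v: "cinner v z = 0" "X = hopf_deriv z v"
    using X z tangent_space_hopf [OF z(1)] by auto
  obtain w where w: "cinner w z = 0" "Y = hopf_deriv z w"
    using Y z tangent_space_hopf [OF z(1)] by auto
  have vw: "cinner v w = 0"
    using cinner_zero_hopf [OF z(1) v(1) w(1)] XY z v w by simp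
  have vv: "cinner v v = 1"
    using XX fs_metric_hopf [OF z(1) v(1) v(1)] v by (simp add: cinner_self power2_norm_eq_inner)
  have zz: "cinner z z = 1" using z by (simp add: cinner_self)
  have zero: "cinner z v = 0" "cinner z w = 0" "cinner w v = 0"
    using v w vw by (simp_all flip: cnj_cinner [of v z] cnj_cinner [of w z] cnj_cinner [of v w])
  have o0: "outer a b ** outer c d = 0" if "cinner c b = 0" for a b c d :: "complex^'a"
    using that by (simp add: outer_mult vec_eq_iff)
  have o1: "outer a b ** outer c d = outer a d" if "cinner c b = 1" for a b c d :: "complex^'a"
    using that by (simp add: outer_mult vec_eq_iff)
  note products = v(2) w(2) hopf_deriv_def matrix_mult.add_left matrix_mult.add_right o0 o1 vw vv zz zero v(1) w(1)
  have XYp: "X ** Y = outer v w" and YXp: "Y ** X = outer w v" and XXp: "X ** X = outer v v + outer z z"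
    by (simp_all add: products)
  have "X ** Y ** X = 0" "Y ** X ** X = outer w z" "X ** X ** Y = outer z w"
    unfolding XYp YXp XXp by (simp_all add: products)
  then have "X ** Y ** X + X ** Y ** X - Y ** X ** X - X ** X ** Y = - Y"
    by (simp add: w(2) hopf_deriv_def)
  then show ?thesis
    by (simp add: riemann_CP [OF P X Y X])
qed

text \<open>
  A Hermitian orthogonal system \<open>S\<close> together with \<open>i S\<close> is orthogonal for the real inner product, and
  the real dimension of the space is twice the complex one.
\<close>

lemma card_le_unitary_dim:
  fixes S :: "(complex^'m::finite) set"
  assumes S: "finite S" "0 \<notin> S" and orth: "\<And>v w. v \<in> S \<Longrightarrow> w \<in> S \<Longrightarrow> v \<noteq> w \<Longrightarrow> cinner v w = 0"
  shows "card S \<le> CARD('m)"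
proof -
  let ?i = "\<lambda>v :: complex^'m. \<i> *s v"
  have ii: "?i v \<bullet> ?i w = v \<bullet> w" for v w
    by (simp add: inner_vec_def inner_complex_def add.commute)
  have i_self: "v \<bullet> ?i v = 0" for v
    by (simp add: inner_vec_def inner_complex_def mult.commute)
  have orth': "v \<bullet> w = 0" "v \<bullet> ?i w = 0" if "v \<in> S" "w \<in> S" "v \<noteq> w" for v w
    using orth [OF that] by (simp_all add: cinner_zero_iff)
  have v_iw: "v \<bullet> ?i w = 0" if "v \<in> S" "w \<in> S" for v w
    using orth'(2) [OF that] i_self by (cases "v = w") auto
  have "pairwise orthogonal (S \<union> ?i ` S)"
    unfolding pairwise_def orthogonal_def
    using orth'(1) v_iw by (auto simp: ii) (metis inner_commute v_iw)+
  moreover have "0 \<notin> S \<union> ?i ` S"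
    using S(2) by (auto simp: vector_mul_eq_0)
  ultimately have "card (S \<union> ?i ` S) \<le> DIM(complex^'m)"
    using pairwise_orthogonal_independent independent_bound by blast
  moreover have "S \<inter> ?i ` S = {}"
  proof -
    have False if "v \<in> S" "w \<in> S" "v = ?i w" for v w
      using v_iw [OF that(1,2)] that S(2) by (metis inner_eq_zero_iff)
    then show ?thesis by blast
  qed
  moreover have "inj_on ?i S"
    by (rule inj_onI) simp
  ultimately show ?thesis
    using S(1) by (simp add: card_Un_disjoint card_image)
qed

text \<open>
  The horizontal lifts of the vectors in \<open>S\<close> to a point \<open>z\<close> of the sphere are Hermitian orthogonal to
  each other and to \<open>z\<close>.
\<close>

lemma card_totally_real_frame:
  fixes P :: "complex^'m::finite^'m"
  assumes P: "P \<in> CP" and S: "finite S" "S \<subseteq> tangent_space CP P" "\<And>X. X \<in> S \<Longrightarrow> fs_metric X X = 1"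
    and orth: "\<And>X Y. X \<in> S \<Longrightarrow> Y \<in> S \<Longrightarrow> X \<noteq> Y \<Longrightarrow> fs_metric X Y = 0 \<and> fs_metric X (cplx_struct P Y) = 0"
  shows "card S + 1 \<le> CARD('m)"
proof -
  obtain z where z: "norm z = 1" "P = hopf z"
    using P by (auto simp: CP_def)
  have "\<forall>X\<in>S. \<exists>v. cinner v z = 0 \<and> X = hopf_deriv z v"
    using S(2) z tangent_space_hopf [OF z(1)] by blast
  then obtain g where g: "\<And>X. X \<in> S \<Longrightarrow> cinner (g X) z = 0" "\<And>X. X \<in> S \<Longrightarrow> X = hopf_deriv z (g X)"
    by metis
  have "inj_on g S"
    using g(2) by (metis inj_onI)
  have zz: "cinner z z = 1" using z by (simp add: cinner_self)
  have norm_g: "g X \<bullet> g X = 1" if "X \<in> S" for X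
    using S(3) [OF that] g [OF that] fs_metric_hopf [OF z(1) g(1) [OF that] g(1) [OF that]] by simp
  have orth_g: "cinner (g X) (g Y) = 0" if "X \<in> S" "Y \<in> S" "X \<noteq> Y" for X Y
    using cinner_zero_hopf [OF z(1) g(1) [OF that(1)] g(1) [OF that(2)]] orth [OF that] g(2) that z(2)
    by simp
  have orth_z: "cinner z (g X) = 0" if "X \<in> S" for X
    using g(1) [OF that] by (simp flip: cnj_cinner [of "g X" z])
  have z_nin: "z \<notin> g ` S"
    using g(1) zz by force
  have "card (insert z (g ` S)) \<le> CARD('m)"
  proof (rule card_le_unitary_dim)
    show "0 \<notin> insert z (g ` S)"
      using norm_g z(1) by force
    show "cinner v w = 0" if "v \<in> insert z (g ` S)" "w \<in> insert z (g ` S)" "v \<noteq> w" for v w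
      using that g(1) orth_z orth_g by auto
  qed (use S(1) in simp)
  then show ?thesis
    using S(1) z_nin \<open>inj_on g S\<close> by (simp add: card_image)
qed


section \<open>Covariant derivatives along a curve\<close>

lemma interval_nontrivial:
  fixes I :: "real set"
  assumes "is_interval I" "interior I \<noteq> {}" "t \<in> I"
  shows "at t within I \<noteq> bot"
proof -
  have "I \<noteq> {x}" for x
    using assms(2) by auto
  then have "t islimpt I"
    using assms connected_imp_perfect is_interval_connected by blast
  then show ?thesis
    by (simp add: trivial_limit_within)
qed

lemma frechet_derivative_within_real:
  assumes I: "at t within I \<noteq> bot" and f: "(f has_vector_derivative v) (at t within I)"
  shows "frechet_derivative f (at t within I) = (\<lambda>h. h *\<^sub>R v)"
proof -
  let ?D = "frechet_derivative f (at t within I)"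
  have D: "(f has_derivative ?D) (at t within I)"
    using differentiableI [OF f [unfolded has_vector_derivative_def]] by (simp add: frechet_derivative_works)
  have lin: "?D = (\<lambda>h. h *\<^sub>R ?D 1)"
  proof
    show "?D h = h *\<^sub>R ?D 1" for h
      using linear_cmul [OF has_derivative_linear [OF D], of h 1] by (simp only: real_scaleR_def mult_1_right)
  qed
  then have "(f has_vector_derivative ?D 1) (at t within I)"
    using D by (simp add: has_vector_derivative_def)
  then have "?D 1 = v"
    using vector_derivative_unique_within [OF I _ f] by blast
  with lin show ?thesis by simp
qed

lemma smooth_on_velocity:
  assumes I: "\<And>t. t \<in> I \<Longrightarrow> at t within I \<noteq> bot" and f: "smooth_on I f"
  shows "t \<in> I \<Longrightarrow> (f has_vector_derivative velocity I f t) (at t within I)"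
    and "smooth_on I (velocity I f)"
proof -
  have "Ck_on (Suc 0) I f" using f unfolding smooth_on_def by blast
  then have f': "(f has_vector_derivative velocity I f t) (at t within I)" if "t \<in> I" for t
    using that by (simp add: velocity_def differentiable_on_def flip: vector_derivative_works)
  then show "t \<in> I \<Longrightarrow> (f has_vector_derivative velocity I f t) (at t within I)" .
  have v: "velocity I f t = frechet_derivative f (at t within I) 1" if "t \<in> I" for t
    using frechet_derivative_within_real [OF I f'] that by simp
  have "Ck_on k I (velocity I f)" for k
  proof -
    have "Ck_on (Suc k) I f" using f unfolding smooth_on_def by blast
    then have "Ck_on k I (\<lambda>t. frechet_derivative f (at t within I) 1)" by simp
    then show ?thesis
      using Ck_on_cong [of I "velocity I f" "\<lambda>t. frechet_derivative f (at t within I) 1" k] v by simp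
  qed
  then show "smooth_on I (velocity I f)"
    by (simp add: smooth_on_def)
qed

text \<open>
  Where \<open>I\<close> has an isolated point the derivative within \<open>I\<close> is not unique, and the one that
  \<open>frechet_derivative\<close> chooses need not be zero.
\<close>

lemma smooth_on_zero:
  fixes I :: "real set"
  assumes I: "\<And>t. t \<in> I \<Longrightarrow> at t within I \<noteq> bot"
  shows "smooth_on I (\<lambda>_. 0)"
proof -
  have "Ck_on n I (\<lambda>_. 0 :: 'a::real_normed_vector)" for n
  proof (induction n)
    case (Suc n)
    have "frechet_derivative (\<lambda>_. 0 :: 'a) (at t within I) v = 0" if "t \<in> I" for t v
      by (subst frechet_derivative_within_real [OF I [OF that] has_vector_derivative_const]) simp
    then have "Ck_on n I (\<lambda>t. frechet_derivative (\<lambda>_. 0 :: 'a) (at t within I) v)" for v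
      using Ck_on_cong [of I "\<lambda>t. frechet_derivative (\<lambda>_. 0 :: 'a) (at t within I) v" "\<lambda>_. 0" n] Suc
      by simp
    then show ?case
      by (simp add: differentiable_on_def)
  qed simp
  then show ?thesis by (simp add: smooth_on_def)
qed

lemma linear_tangent_part:
  assumes T: "subspace (tangent_space M p)"
  shows "linear (tangent_part M p)"
proof (rule linearI)
  note mem = tangent_part_mem [OF T] and orth = tangent_part_orthogonal [OF T]
  show "tangent_part M p (a + b) = tangent_part M p a + tangent_part M p b" for a b
    by (rule tangent_part_unique [OF T]) (simp_all add: subspace_add T mem orth inner_add_left)
  show "tangent_part M p (r *\<^sub>R a) = r *\<^sub>R tangent_part M p a" for r a
    by (rule tangent_part_unique [OF T]) (simp_all add: subspace_scale T mem orth)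
qed

lemma tangent_part_tangent:
  assumes "subspace (tangent_space M p)" "x \<in> tangent_space M p"
  shows "tangent_part M p x = x"
  by (rule tangent_part_unique [OF assms]) (rule refl)

lemma cov_deriv_eq:
  assumes "at t within I \<noteq> bot" "(V has_vector_derivative V') (at t within I)"
  shows "cov_deriv M I \<gamma> V t = tangent_part M (\<gamma> t) V'"
  using assms by (simp add: cov_deriv_def vector_derivative_within)

section \<open>Frenet curves\<close>

locale frenet_CP =
  fixes I :: "real set" and \<gamma> :: "real \<Rightarrow> complex^'m::finite^'m"
    and d :: nat and E :: "nat \<Rightarrow> real \<Rightarrow> complex^'m^'m" and k :: "nat \<Rightarrow> real \<Rightarrow> real"
  assumes interval: "is_interval I" "interior I \<noteq> {}"
    and frenet: "frenet_curve I \<gamma> d E k"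
begin

text \<open>
  Outside the range of their indices the frame fields and curvatures are replaced by zero, so that the
  Frenet equations take the same form for every index, including both ends of the frame
  (\<open>cov_deriv_frame\<close>).
\<close>

definition frame :: "nat \<Rightarrow> real \<Rightarrow> complex^'m^'m" where
  "frame i = (if 1 \<le> i \<and> i \<le> d then E i else (\<lambda>_. 0))"

definition curv :: "nat \<Rightarrow> real \<Rightarrow> real" where
  "curv i = (if 1 \<le> i \<and> i < d then k i else (\<lambda>_. 0))"

lemma nontrivial: "t \<in> I \<Longrightarrow> at t within I \<noteq> bot"
  using interval interval_nontrivial by blast

lemma gamma_CP: "t \<in> I \<Longrightarrow> \<gamma> t \<in> CP"
  using frenet by (auto simp: frenet_curve_def)

lemma subspace_gamma: "t \<in> I \<Longrightarrow> subspace (tangent_space CP (\<gamma> t))"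
  using gamma_CP subspace_tangent_space_CP by blast

lemma d_pos: "1 \<le> d"
  using frenet by (simp add: frenet_curve_def)

lemma frame_tangent: "t \<in> I \<Longrightarrow> frame i t \<in> tangent_space CP (\<gamma> t)"
  using frenet subspace_0 [OF subspace_gamma, of t] by (auto simp: frame_def frenet_curve_def)

lemma frame_orthonormal:
  "t \<in> I \<Longrightarrow> fs_metric (frame i t) (frame j t) = (if i = j \<and> 1 \<le> i \<and> i \<le> d then 1 else 0)"
  using frenet by (auto simp: frame_def frenet_curve_def fs_metric_def)

lemma smooth_frame: "smooth_on I (frame i)"
  using frenet smooth_on_zero [OF nontrivial] by (auto simp: frame_def frenet_curve_def)

definition frame1 :: "nat \<Rightarrow> real \<Rightarrow> complex^'m^'m" where "frame1 i = velocity I (frame i)"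
definition frame2 :: "nat \<Rightarrow> real \<Rightarrow> complex^'m^'m" where "frame2 i = velocity I (frame1 i)"
definition frame3 :: "nat \<Rightarrow> real \<Rightarrow> complex^'m^'m" where "frame3 i = velocity I (frame2 i)"

lemma frame_derivatives:
  assumes "t \<in> I"
  shows "(frame i has_vector_derivative frame1 i t) (at t within I)"
    "(frame1 i has_vector_derivative frame2 i t) (at t within I)"
    "(frame2 i has_vector_derivative frame3 i t) (at t within I)"
proof -
  have 1: "smooth_on I (frame1 i)" unfolding frame1_def by (intro smooth_on_velocity nontrivial smooth_frame)
  then have 2: "smooth_on I (frame2 i)" unfolding frame2_def by (intro smooth_on_velocity nontrivial)
  show "(frame i has_vector_derivative frame1 i t) (at t within I)"
    "(frame1 i has_vector_derivative frame2 i t) (at t within I)"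
    "(frame2 i has_vector_derivative frame3 i t) (at t within I)"
    unfolding frame1_def [of i, abs_def] frame3_def frame2_def [of i, abs_def]
    using assms smooth_frame 1 2 by (auto intro!: smooth_on_velocity(1) nontrivial simp: frame1_def frame2_def)
qed

lemma velocity_gamma: "t \<in> I \<Longrightarrow> velocity I \<gamma> t = frame 1 t"
  using frenet d_pos by (auto simp: frame_def frenet_curve_def)

lemma gamma_has_derivative: "t \<in> I \<Longrightarrow> (\<gamma> has_vector_derivative frame 1 t) (at t within I)"
  using smooth_on_velocity(1) [OF nontrivial, of \<gamma> t] frenet velocity_gamma
  by (simp add: frenet_curve_def)

lemma cov_deriv_frame_tangent_part: "t \<in> I \<Longrightarrow> cov_deriv CP I \<gamma> (frame i) t = tangent_part CP (\<gamma> t) (frame1 i t)"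
  by (rule cov_deriv_eq [OF nontrivial frame_derivatives(1)])

lemma cov_deriv_frame:
  assumes t: "t \<in> I"
  shows "cov_deriv CP I \<gamma> (frame i) t = - curv (i - 1) t *\<^sub>R frame (i - 1) t + curv i t *\<^sub>R frame (Suc i) t"
proof (cases "1 \<le> i \<and> i \<le> d")
  case True
  then show ?thesis
    using frenet t d_pos by (auto simp: frame_def curv_def frenet_curve_def)
next
  case False
  then have "frame i = (\<lambda>_. 0)" "curv i = (\<lambda>_. 0)" by (auto simp: frame_def curv_def)
  moreover have "curv (i - 1) t *\<^sub>R frame (i - 1) t = 0"
    using False by (auto simp: curv_def frame_def)
  moreover have "cov_deriv CP I \<gamma> (\<lambda>_. 0) t = 0"
    using cov_deriv_eq [OF nontrivial [OF t] has_vector_derivative_const, of CP \<gamma>]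
      linear_0 [OF linear_tangent_part [OF subspace_gamma [OF t]]] by simp
  ultimately show ?thesis by simp
qed

lemma inner_frame1: "t \<in> I \<Longrightarrow> X \<in> tangent_space CP (\<gamma> t) \<Longrightarrow> frame1 i t \<bullet> X = cov_deriv CP I \<gamma> (frame i) t \<bullet> X"
  by (simp add: cov_deriv_frame_tangent_part tangent_part_orthogonal subspace_gamma)

text \<open>
  The curvatures are differentiable because the frame is smooth: \<open>curv1\<close> and \<open>curv2\<close> are the first two
  derivatives of the expression in \<open>curv_eq\<close>.
\<close>

definition curv1 :: "nat \<Rightarrow> real \<Rightarrow> real" where
  "curv1 i t = (frame1 i t \<bullet> frame1 (Suc i) t + frame2 i t \<bullet> frame (Suc i) t) / 2"

definition curv2 :: "nat \<Rightarrow> real \<Rightarrow> real" where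
  "curv2 i t = ((frame1 i t \<bullet> frame2 (Suc i) t + frame2 i t \<bullet> frame1 (Suc i) t) +
     (frame2 i t \<bullet> frame1 (Suc i) t + frame3 i t \<bullet> frame (Suc i) t)) / 2"

lemma curv_eq:
  assumes t: "t \<in> I" shows "curv i t = (frame1 i t \<bullet> frame (Suc i) t) / 2"
proof -
  have "frame1 i t \<bullet> frame (Suc i) t =
      - curv (i - 1) t * (frame (i - 1) t \<bullet> frame (Suc i) t) + curv i t * (frame (Suc i) t \<bullet> frame (Suc i) t)"
    by (simp only: inner_frame1 [OF t frame_tangent [OF t]] cov_deriv_frame [OF t] inner_add_left inner_scaleR_left)
  also have "frame (i - 1) t \<bullet> frame (Suc i) t = 0"
  proof -
    have "i - 1 \<noteq> Suc i" by simp
    then show ?thesis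
      using frame_orthonormal [OF t, of "i - 1" "Suc i"] by (simp add: fs_metric_def)
  qed
  also have "curv i t * (frame (Suc i) t \<bullet> frame (Suc i) t) = 2 * curv i t"
    using frame_orthonormal [OF t, of "Suc i" "Suc i"] by (auto simp: fs_metric_def curv_def)
  finally show ?thesis by simp
qed

lemma cov_deriv_frame123:
  assumes t: "t \<in> I"
  shows "cov_deriv CP I \<gamma> (frame 1) t = curv 1 t *\<^sub>R frame 2 t"
    "cov_deriv CP I \<gamma> (frame 2) t = - curv 1 t *\<^sub>R frame 1 t + curv 2 t *\<^sub>R frame 3 t"
    "cov_deriv CP I \<gamma> (frame 3) t = - curv 2 t *\<^sub>R frame 2 t + curv 3 t *\<^sub>R frame 4 t"
  using cov_deriv_frame [OF t, of 1] cov_deriv_frame [OF t, of 2] cov_deriv_frame [OF t, of 3]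
  by (simp_all add: curv_def eval_nat_numeral)

lemma curv_has_derivative:
  assumes t: "t \<in> I"
  shows "(curv i has_vector_derivative curv1 i t) (at t within I)"
    "(curv1 i has_vector_derivative curv2 i t) (at t within I)"
proof -
  note inner' = bounded_bilinear.has_vector_derivative [OF bounded_bilinear_inner]
  have "((\<lambda>s. (frame1 i s \<bullet> frame (Suc i) s) / 2) has_vector_derivative curv1 i t) (at t within I)"
    unfolding curv1_def
    by (intro has_vector_derivative_divide inner' frame_derivatives t)
  then show "(curv i has_vector_derivative curv1 i t) (at t within I)"
    by (rule has_vector_derivative_transform [OF t, rotated]) (simp add: curv_eq)
  show "(curv1 i has_vector_derivative curv2 i t) (at t within I)"
    unfolding curv1_def [of i, abs_def] curv2_def
    by (intro has_vector_derivative_divide has_vector_derivative_add inner' frame_derivatives t)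
qed

lemma cov_deriv_scaleR_frame:
  assumes t: "t \<in> I" and f: "(f has_vector_derivative f') (at t within I)"
  shows "((\<lambda>s. f s *\<^sub>R frame i s) has_vector_derivative f t *\<^sub>R frame1 i t + f' *\<^sub>R frame i t) (at t within I)"
    "tangent_part CP (\<gamma> t) (f t *\<^sub>R frame1 i t + f' *\<^sub>R frame i t) =
      f t *\<^sub>R cov_deriv CP I \<gamma> (frame i) t + f' *\<^sub>R frame i t"
proof -
  note lin = linear_tangent_part [OF subspace_gamma [OF t]]
  show "((\<lambda>s. f s *\<^sub>R frame i s) has_vector_derivative f t *\<^sub>R frame1 i t + f' *\<^sub>R frame i t) (at t within I)"
    by (rule bounded_bilinear.has_vector_derivative [OF bounded_bilinear_scaleR f frame_derivatives(1) [OF t]])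
  show "tangent_part CP (\<gamma> t) (f t *\<^sub>R frame1 i t + f' *\<^sub>R frame i t) =
      f t *\<^sub>R cov_deriv CP I \<gamma> (frame i) t + f' *\<^sub>R frame i t"
    by (simp add: linear_add [OF lin] linear_cmul [OF lin] cov_deriv_frame_tangent_part [OF t]
        tangent_part_tangent [OF subspace_gamma [OF t] frame_tangent [OF t]])
qed

lemma tension_eq: "t \<in> I \<Longrightarrow> tension CP I \<gamma> t = curv 1 t *\<^sub>R frame 2 t"
proof -
  assume t: "t \<in> I"
  have "(velocity I \<gamma> has_vector_derivative frame1 1 t) (at t within I)"
    by (rule has_vector_derivative_transform [OF t _ frame_derivatives(1) [OF t]]) (simp add: velocity_gamma)
  then have "tension CP I \<gamma> t = cov_deriv CP I \<gamma> (frame 1) t"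
    by (simp add: tension_def cov_deriv_eq [OF nontrivial [OF t]] cov_deriv_frame_tangent_part [OF t])
  then show ?thesis
    by (simp only: cov_deriv_frame123 [OF t])
qed

lemma cov_deriv_tension:
  assumes t: "t \<in> I"
  shows "cov_deriv CP I \<gamma> (tension CP I \<gamma>) t =
    - (curv 1 t)\<^sup>2 *\<^sub>R frame 1 t + curv1 1 t *\<^sub>R frame 2 t + (curv 1 t * curv 2 t) *\<^sub>R frame 3 t"
proof -
  note der = cov_deriv_scaleR_frame [OF t curv_has_derivative(1) [OF t], of 1 2]
  have "(tension CP I \<gamma> has_vector_derivative curv 1 t *\<^sub>R frame1 2 t + curv1 1 t *\<^sub>R frame 2 t) (at t within I)"
    by (rule has_vector_derivative_transform [OF t _ der(1)]) (simp add: tension_eq)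
  then show ?thesis
    by (simp only: cov_deriv_eq [OF nontrivial [OF t]] der(2) cov_deriv_frame123 [OF t])
      (simp add: power2_eq_square algebra_simps)
qed

lemma cov_deriv_cov_deriv_tension:
  assumes t: "t \<in> I"
  shows "cov_deriv CP I \<gamma> (cov_deriv CP I \<gamma> (tension CP I \<gamma>)) t =
    (- 3 * curv 1 t * curv1 1 t) *\<^sub>R frame 1 t +
    (curv2 1 t - curv 1 t ^ 3 - curv 1 t * (curv 2 t)\<^sup>2) *\<^sub>R frame 2 t +
    (2 * curv1 1 t * curv 2 t + curv 1 t * curv1 2 t) *\<^sub>R frame 3 t +
    (curv 1 t * curv 2 t * curv 3 t) *\<^sub>R frame 4 t"
proof -
  have sq: "((\<lambda>s. - (curv 1 s)\<^sup>2) has_vector_derivative - (2 * curv 1 t * curv1 1 t)) (at t within I)"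
    unfolding power2_eq_square
    by (rule has_vector_derivative_eq_rhs [OF has_vector_derivative_minus [OF has_vector_derivative_mult
            [OF curv_has_derivative(1) [OF t] curv_has_derivative(1) [OF t]]]]) simp
  have prod: "((\<lambda>s. curv 1 s * curv 2 s) has_vector_derivative curv 1 t * curv1 2 t + curv1 1 t * curv 2 t) (at t within I)"
    by (rule has_vector_derivative_mult [OF curv_has_derivative(1) [OF t] curv_has_derivative(1) [OF t]])
  note d1 = cov_deriv_scaleR_frame [OF t sq, of 1] and d2 = cov_deriv_scaleR_frame [OF t curv_has_derivative(2) [OF t], of 1 2]
    and d3 = cov_deriv_scaleR_frame [OF t prod, of 3]
  note sum = has_vector_derivative_add [OF has_vector_derivative_add [OF d1(1) d2(1)] d3(1)]
  note lin = linear_tangent_part [OF subspace_gamma [OF t]]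
  have "cov_deriv CP I \<gamma> (cov_deriv CP I \<gamma> (tension CP I \<gamma>)) t =
      (- (curv 1 t)\<^sup>2 *\<^sub>R cov_deriv CP I \<gamma> (frame 1) t + - (2 * curv 1 t * curv1 1 t) *\<^sub>R frame 1 t) +
      (curv1 1 t *\<^sub>R cov_deriv CP I \<gamma> (frame 2) t + curv2 1 t *\<^sub>R frame 2 t) +
      ((curv 1 t * curv 2 t) *\<^sub>R cov_deriv CP I \<gamma> (frame 3) t + (curv 1 t * curv1 2 t + curv1 1 t * curv 2 t) *\<^sub>R frame 3 t)"
    unfolding d1(2) [symmetric] d2(2) [symmetric] d3(2) [symmetric] linear_add [OF lin, symmetric]
    by (rule cov_deriv_eq [OF nontrivial [OF t] has_vector_derivative_transform [OF t _ sum]])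
      (simp add: cov_deriv_tension)
  also have "\<dots> = (- (2 * curv 1 t * curv1 1 t) + curv1 1 t * - curv 1 t) *\<^sub>R frame 1 t +
      (- (curv 1 t)\<^sup>2 * curv 1 t + curv2 1 t + (curv 1 t * curv 2 t) * - curv 2 t) *\<^sub>R frame 2 t +
      (curv1 1 t * curv 2 t + (curv 1 t * curv1 2 t + curv1 1 t * curv 2 t)) *\<^sub>R frame 3 t +
      ((curv 1 t * curv 2 t) * curv 3 t) *\<^sub>R frame 4 t"
    by (simp only: cov_deriv_frame123 [OF t] scaleR_add_left scaleR_add_right scaleR_scaleR add_ac)
  also have "\<dots> = (- 3 * curv 1 t * curv1 1 t) *\<^sub>R frame 1 t +
    (curv2 1 t - curv 1 t ^ 3 - curv 1 t * (curv 2 t)\<^sup>2) *\<^sub>R frame 2 t +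
    (2 * curv1 1 t * curv 2 t + curv 1 t * curv1 2 t) *\<^sub>R frame 3 t +
    (curv 1 t * curv 2 t * curv 3 t) *\<^sub>R frame 4 t"
  proof -
    have "- (2 * curv 1 t * curv1 1 t) + curv1 1 t * - curv 1 t = - 3 * curv 1 t * curv1 1 t"
      "- (curv 1 t)\<^sup>2 * curv 1 t + curv2 1 t + (curv 1 t * curv 2 t) * - curv 2 t = curv2 1 t - curv 1 t ^ 3 - curv 1 t * (curv 2 t)\<^sup>2"
      "curv1 1 t * curv 2 t + (curv 1 t * curv1 2 t + curv1 1 t * curv 2 t) = 2 * curv1 1 t * curv 2 t + curv 1 t * curv1 2 t"
      by (simp_all add: power2_eq_square power3_eq_cube algebra_simps)
    then show ?thesis by (simp only:)
  qed
  finally show ?thesis .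
qed

text \<open>
  The term with the derivative of \<open>J\<close> vanishes by \<open>inner_cplx_struct_tangent_zero\<close>, and the derivatives
  of the frame fields may be replaced by their tangential parts because \<open>J\<close> preserves tangent vectors.
\<close>

lemma complex_torsion_has_derivative:
  assumes t: "t \<in> I"
  shows "(complex_torsion \<gamma> frame i j has_vector_derivative
    fs_metric (cov_deriv CP I \<gamma> (frame i) t) (cplx_struct (\<gamma> t) (frame j t)) +
    fs_metric (frame i t) (cplx_struct (\<gamma> t) (cov_deriv CP I \<gamma> (frame j) t))) (at t within I)"
proof -
  have J: "cplx_struct (\<gamma> t) (frame l t) \<in> tangent_space CP (\<gamma> t)" for l
    by (rule cplx_struct_tangent [OF gamma_CP [OF t] frame_tangent [OF t]])
  note skew = inner_cplx_struct_skew [OF CP_adjoint [OF gamma_CP [OF t]]]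
  have skew': "a \<bullet> cplx_struct (\<gamma> t) b = - (b \<bullet> cplx_struct (\<gamma> t) a)" for a b
    using skew [of a b] by (simp add: inner_commute)
  have "((\<lambda>s. (frame i s \<bullet> cplx_struct (\<gamma> s) (frame j s)) / 2) has_vector_derivative
      (frame i t \<bullet> (cplx_struct (\<gamma> t) (frame1 j t) + cplx_struct (frame 1 t) (frame j t)) +
       frame1 i t \<bullet> cplx_struct (\<gamma> t) (frame j t)) / 2) (at t within I)"
    by (intro has_vector_derivative_divide gamma_has_derivative t frame_derivatives
        bounded_bilinear.has_vector_derivative [OF bounded_bilinear_inner]
        bounded_bilinear.has_vector_derivative [OF bounded_bilinear_cplx_struct])
  moreover have "frame i t \<bullet> cplx_struct (frame 1 t) (frame j t) = 0"
    by (rule inner_cplx_struct_tangent_zero [OF gamma_CP [OF t]]) (rule frame_tangent [OF t])+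
  moreover have "frame i t \<bullet> cplx_struct (\<gamma> t) (frame1 j t) = frame i t \<bullet> cplx_struct (\<gamma> t) (cov_deriv CP I \<gamma> (frame j) t)"
    unfolding skew' [of "frame i t"] inner_frame1 [OF t J] ..
  ultimately show ?thesis
    unfolding complex_torsion_def [of \<gamma> frame i j, abs_def] fs_metric_def
    by (simp add: inner_frame1 [OF t J] inner_add_right add_divide_distrib add.commute)
qed

lemma bitension_eq:
  assumes t: "t \<in> I" and torsion: "complex_torsion \<gamma> frame 1 2 t = 0"
  shows "bitension CP I \<gamma> t =
    (- 3 * curv 1 t * curv1 1 t) *\<^sub>R frame 1 t +
    (curv2 1 t - curv 1 t ^ 3 - curv 1 t * (curv 2 t)\<^sup>2 + curv 1 t) *\<^sub>R frame 2 t +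
    (2 * curv1 1 t * curv 2 t + curv 1 t * curv1 2 t) *\<^sub>R frame 3 t +
    (curv 1 t * curv 2 t * curv 3 t) *\<^sub>R frame 4 t"
proof -
  note scale = bounded_bilinear.scaleR_right [OF bounded_bilinear_cplx_struct]
  have "riemann CP (\<gamma> t) (frame 1 t) (curv 1 t *\<^sub>R frame 2 t) (frame 1 t) = - (curv 1 t *\<^sub>R frame 2 t)"
  proof (rule riemann_CP_totally_real [OF gamma_CP [OF t] frame_tangent [OF t]])
    show "curv 1 t *\<^sub>R frame 2 t \<in> tangent_space CP (\<gamma> t)"
      by (rule subspace_scale [OF subspace_gamma [OF t] frame_tangent [OF t]])
    show "fs_metric (frame 1 t) (frame 1 t) = 1"
      using frame_orthonormal [OF t, of 1 1] d_pos by simp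
    show "fs_metric (frame 1 t) (curv 1 t *\<^sub>R frame 2 t) = 0"
      using frame_orthonormal [OF t, of 1 2] by (simp add: fs_metric_def)
    show "fs_metric (frame 1 t) (cplx_struct (\<gamma> t) (curv 1 t *\<^sub>R frame 2 t)) = 0"
      using torsion by (simp add: complex_torsion_def fs_metric_def scale)
  qed
  then show ?thesis
    by (simp add: bitension_def rough_laplacian_def cov_deriv_cov_deriv_tension [OF t] tension_eq [OF t]
        velocity_gamma [OF t] scaleR_add_left)
qed

lemma inner_combination:
  assumes t: "t \<in> I" and "i \<in> {1, 2, 3, 4}" "i \<le> d"
    and zero: "a 1 *\<^sub>R frame 1 t + a 2 *\<^sub>R frame 2 t + a 3 *\<^sub>R frame 3 t + a 4 *\<^sub>R frame 4 t = (0 :: complex^'m^'m)"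
  shows "a (i::nat) = (0::real)"
proof -
  have "(a 1 *\<^sub>R frame 1 t + a 2 *\<^sub>R frame 2 t + a 3 *\<^sub>R frame 3 t + a 4 *\<^sub>R frame 4 t) \<bullet> frame i t = 0"
    using zero by simp
  then have "a 1 * fs_metric (frame 1 t) (frame i t) + a 2 * fs_metric (frame 2 t) (frame i t) +
      a 3 * fs_metric (frame 3 t) (frame i t) + a 4 * fs_metric (frame 4 t) (frame i t) = 0"
    by (simp add: fs_metric_def inner_add_left)
  then show ?thesis
    using assms(2,3) by (auto simp: frame_orthonormal [OF t])
qed


section \<open>Biharmonic Frenet curves\<close>

lemma derivative_zero:
  assumes t: "t \<in> I" and f: "(f has_vector_derivative f') (at t within I)" and const: "\<And>s. s \<in> I \<Longrightarrow> f s = c"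
  shows "f' = (0::real)"
proof -
  have "(f has_vector_derivative 0) (at t within I)"
    by (rule has_vector_derivative_transform [OF t const has_vector_derivative_const])
  then show ?thesis
    using vector_derivative_unique_within [OF nontrivial [OF t] f] by blast
qed

lemma curv_constant:
  assumes "\<And>t. t \<in> I \<Longrightarrow> curv1 i t = 0"
  obtains c where "\<And>t. t \<in> I \<Longrightarrow> curv i t = c"
proof -
  have "(curv i has_derivative (\<lambda>h. 0)) (at t within I)" if "t \<in> I" for t
    using curv_has_derivative(1) [OF that, of i] assms [OF that] by (simp add: has_vector_derivative_def)
  then show ?thesis
    using has_derivative_zero_constant [of I "curv i"] interval(1) that is_interval_convex by blast
qed

lemma curv_pos: "t \<in> I \<Longrightarrow> 1 \<le> i \<Longrightarrow> i < d \<Longrightarrow> curv i t > 0"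
  using frenet by (auto simp: curv_def frenet_curve_def)

lemma curv_zero: "d \<le> i \<Longrightarrow> curv i t = 0"
  by (simp add: curv_def)

lemma harmonic_iff: "harmonic_curve CP I \<gamma> \<longleftrightarrow> d = 1"
proof
  assume "d = 1"
  then have "curv 1 t = 0" for t
    by (intro curv_zero) simp
  then show "harmonic_curve CP I \<gamma>"
    by (simp add: harmonic_curve_def tension_eq)
next
  assume h: "harmonic_curve CP I \<gamma>"
  obtain t where t: "t \<in> I"
    using interval(2) interior_subset by blast
  have "\<not> 1 < d"
  proof
    assume d: "1 < d"
    have "frame 2 t \<noteq> 0"
      using frame_orthonormal [OF t, of 2 2] d by (auto simp: fs_metric_def)
    then show False
      using h t curv_pos [OF t, of 1] d by (auto simp: harmonic_curve_def tension_eq)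
  qed
  then show "d = 1" using d_pos by simp
qed

lemma totally_real_frame_dim:
  assumes t: "t \<in> I" and m: "m \<le> d"
    and torsion: "\<And>i j. 1 \<le> i \<Longrightarrow> i < j \<Longrightarrow> j \<le> m \<Longrightarrow> complex_torsion \<gamma> frame i j t = 0"
  shows "m + 1 \<le> CARD('m)"
proof -
  have inj: "inj_on (\<lambda>i. frame i t) {1..m}"
  proof (rule inj_onI)
    fix i j assume "i \<in> {1..m}" "j \<in> {1..m}" "frame i t = frame j t"
    then show "i = j"
      using frame_orthonormal [OF t, of i i] frame_orthonormal [OF t, of i j] m by (auto split: if_splits)
  qed
  have torsion': "fs_metric (frame i t) (cplx_struct (\<gamma> t) (frame j t)) = 0" if "i \<in> {1..m}" "j \<in> {1..m}" "i \<noteq> j" for i j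
  proof (cases "i < j")
    case True
    then show ?thesis using torsion [of i j] that by (simp add: complex_torsion_def)
  next
    case False
    then have "fs_metric (frame j t) (cplx_struct (\<gamma> t) (frame i t)) = 0"
      using torsion [of j i] that by (simp add: complex_torsion_def)
    then show ?thesis
      using fs_cplx_struct_skew [OF gamma_CP [OF t], of "frame i t" "frame j t"] by simp
  qed
  have "card ((\<lambda>i. frame i t) ` {1..m}) + 1 \<le> CARD('m)"
  proof (rule card_totally_real_frame [OF gamma_CP [OF t]])
    show "(\<lambda>i. frame i t) ` {1..m} \<subseteq> tangent_space CP (\<gamma> t)"
      using frame_tangent [OF t] by auto
    show "fs_metric X X = 1" if "X \<in> (\<lambda>i. frame i t) ` {1..m}" for X
      using that frame_orthonormal [OF t] m by auto
    show "fs_metric X Y = 0 \<and> fs_metric X (cplx_struct (\<gamma> t) Y) = 0"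
      if "X \<in> (\<lambda>i. frame i t) ` {1..m}" "Y \<in> (\<lambda>i. frame i t) ` {1..m}" "X \<noteq> Y" for X Y
    proof -
      obtain i where i: "i \<in> {1..m}" "X = frame i t"
        using \<open>X \<in> _\<close> by blast
      obtain j where j: "j \<in> {1..m}" "Y = frame j t"
        using \<open>Y \<in> _\<close> by blast
      from i j \<open>X \<noteq> Y\<close> have "i \<noteq> j"
        by blast
      then show ?thesis
        using i j torsion' frame_orthonormal [OF t, of i j] by simp
    qed
  qed simp
  then show ?thesis
    unfolding card_image [OF inj] by simp
qed

text \<open>
  By the Frenet equations. In the derivative of \<open>\<tau>\<^sub>1\<^sub>2\<close> the terms with \<open>\<langle>E\<^sub>1, J E\<^sub>1\<rangle>\<close> and
  \<open>\<langle>E\<^sub>2, J E\<^sub>2\<rangle>\<close> vanish because \<open>J\<close> is skew.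
\<close>

lemma torsion_derivatives:
  assumes t: "t \<in> I"
  shows "(complex_torsion \<gamma> frame 1 2 has_vector_derivative curv 2 t * complex_torsion \<gamma> frame 1 3 t) (at t within I)"
    "(complex_torsion \<gamma> frame 1 3 has_vector_derivative
      curv 1 t * complex_torsion \<gamma> frame 2 3 t - curv 2 t * complex_torsion \<gamma> frame 1 2 t +
      curv 3 t * complex_torsion \<gamma> frame 1 4 t) (at t within I)"
proof -
  interpret J: bounded_bilinear "cplx_struct :: complex^'m^'m \<Rightarrow> _"
    by (rule bounded_bilinear_cplx_struct)
  have fs: "fs_metric (X + Y) Z = fs_metric X Z + fs_metric Y Z"
    "fs_metric Z (X + Y) = fs_metric Z X + fs_metric Z Y"
    "fs_metric (r *\<^sub>R X) Y = r * fs_metric X Y" "fs_metric X (r *\<^sub>R Y) = r * fs_metric X Y"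
    for X Y Z :: "complex^'m^'m" and r
    by (simp_all add: fs_metric_def inner_add_left inner_add_right add_divide_distrib)
  note J_self = fs_cplx_struct_self [OF gamma_CP [OF t]]
  show "(complex_torsion \<gamma> frame 1 2 has_vector_derivative curv 2 t * complex_torsion \<gamma> frame 1 3 t) (at t within I)"
    using complex_torsion_has_derivative [OF t, of 1 2]
    by (simp only: cov_deriv_frame123 [OF t] J.add_right J.scaleR_right fs J_self complex_torsion_def) simp
  show "(complex_torsion \<gamma> frame 1 3 has_vector_derivative
      curv 1 t * complex_torsion \<gamma> frame 2 3 t - curv 2 t * complex_torsion \<gamma> frame 1 2 t +
      curv 3 t * complex_torsion \<gamma> frame 1 4 t) (at t within I)"
    using complex_torsion_has_derivative [OF t, of 1 3]
    by (simp only: cov_deriv_frame123 [OF t] J.add_right J.scaleR_right fs complex_torsion_def)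
      (simp add: algebra_simps)
qed

lemma torsions_zero:
  assumes torsion: "\<And>t. t \<in> I \<Longrightarrow> complex_torsion \<gamma> frame 1 2 t = 0" and d: "d = 3" and t: "t \<in> I"
  shows "complex_torsion \<gamma> frame 1 3 t = 0" "complex_torsion \<gamma> frame 2 3 t = 0"
proof -
  have 13: "complex_torsion \<gamma> frame 1 3 s = 0" if "s \<in> I" for s
    using derivative_zero [OF that torsion_derivatives(1) [OF that] torsion] curv_pos [OF that, of 2] d by simp
  then show "complex_torsion \<gamma> frame 1 3 t = 0" using t .
  have "curv 3 t = 0" "curv 1 t > 0"
    using d by (intro curv_zero curv_pos t; simp)+
  then show "complex_torsion \<gamma> frame 2 3 t = 0"
    using derivative_zero [OF t torsion_derivatives(2) [OF t] 13] torsion [OF t] by simp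
qed

lemma dim_bound:
  assumes torsion: "\<And>t. t \<in> I \<Longrightarrow> complex_torsion \<gamma> frame 1 2 t = 0" and d: "2 \<le> d" "d \<le> 3"
  shows "d + 1 \<le> CARD('m)"
proof -
  obtain t where t: "t \<in> I"
    using interval(2) interior_subset by blast
  show ?thesis
  proof (rule totally_real_frame_dim [OF t order_refl])
    fix i j assume ij: "1 \<le> i" "i < j" "j \<le> d"
    show "complex_torsion \<gamma> frame i j t = 0"
    proof (cases "j = 2")
      case True
      then have "i = 1" using ij by simp
      with True show ?thesis using torsion [OF t] by simp
    next
      case False
      then have "d = 3" "j = 3" "i = 1 \<or> i = 2" using ij d by auto
      then show ?thesis using torsions_zero [OF torsion _ t] by auto
    qed
  qed
qed

lemma biharmonic_imp_helix:
  assumes torsion: "\<And>t. t \<in> I \<Longrightarrow> complex_torsion \<gamma> frame 1 2 t = 0" and d: "2 \<le> d"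
    and biharmonic: "biharmonic_curve CP I \<gamma>"
  shows "d \<le> 3" "\<And>t. t \<in> I \<Longrightarrow> (curv 1 t)\<^sup>2 + (curv 2 t)\<^sup>2 = 1" "frenet_helix I \<gamma> d E k"
proof -
  have coeff:
    "1 \<le> d \<Longrightarrow> - 3 * curv 1 t * curv1 1 t = 0"
    "2 \<le> d \<Longrightarrow> curv2 1 t - curv 1 t ^ 3 - curv 1 t * (curv 2 t)\<^sup>2 + curv 1 t = 0"
    "3 \<le> d \<Longrightarrow> 2 * curv1 1 t * curv 2 t + curv 1 t * curv1 2 t = 0"
    "4 \<le> d \<Longrightarrow> curv 1 t * curv 2 t * curv 3 t = 0" if t: "t \<in> I" for t
  proof -
    \<comment> \<open>The coefficients of the bitension field, gathered for \<open>inner_combination\<close>.\<close>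
    define a :: "nat \<Rightarrow> real" where "a i = (if i = 1 then - 3 * curv 1 t * curv1 1 t
      else if i = 2 then curv2 1 t - curv 1 t ^ 3 - curv 1 t * (curv 2 t)\<^sup>2 + curv 1 t
      else if i = 3 then 2 * curv1 1 t * curv 2 t + curv 1 t * curv1 2 t
      else curv 1 t * curv 2 t * curv 3 t)" for i
    have "a 1 *\<^sub>R frame 1 t + a 2 *\<^sub>R frame 2 t + a 3 *\<^sub>R frame 3 t + a 4 *\<^sub>R frame 4 t = 0"
      using biharmonic t bitension_eq [OF t torsion [OF t]] by (simp add: biharmonic_curve_def a_def)
    note zero = inner_combination [OF t _ _ this]
    show "1 \<le> d \<Longrightarrow> - 3 * curv 1 t * curv1 1 t = 0"
      "2 \<le> d \<Longrightarrow> curv2 1 t - curv 1 t ^ 3 - curv 1 t * (curv 2 t)\<^sup>2 + curv 1 t = 0"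
      "3 \<le> d \<Longrightarrow> 2 * curv1 1 t * curv 2 t + curv 1 t * curv1 2 t = 0"
      "4 \<le> d \<Longrightarrow> curv 1 t * curv 2 t * curv 3 t = 0"
      using zero [of 1] zero [of 2] zero [of 3] zero [of 4] by (simp_all add: a_def)
  qed
  have curv_pos1: "curv 1 t > 0" if "t \<in> I" for t
    using curv_pos [OF that, of 1] d by simp
  have curv1_zero: "curv1 1 t = 0" if "t \<in> I" for t
    using coeff(1) [OF that] curv_pos1 [OF that] d by simp
  have curv2_zero: "curv2 1 t = 0" if "t \<in> I" for t
    by (rule derivative_zero [OF that curv_has_derivative(2) [OF that] curv1_zero])
  show d3: "d \<le> 3"
  proof (rule ccontr)
    assume "\<not> d \<le> 3"
    then have d4: "4 \<le> d" by simp
    obtain t where t: "t \<in> I"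
      using interval(2) interior_subset by blast
    have "curv 1 t > 0" "curv 2 t > 0" "curv 3 t > 0"
      using d4 by (simp_all add: curv_pos [OF t])
    then show False
      using coeff(4) [OF t d4] by simp
  qed
  show "(curv 1 t)\<^sup>2 + (curv 2 t)\<^sup>2 = 1" if "t \<in> I" for t
  proof -
    have "curv 1 t * ((curv 1 t)\<^sup>2 + (curv 2 t)\<^sup>2 - 1) = 0"
      using coeff(2) [OF that d] curv2_zero [OF that] by (simp add: algebra_simps power2_eq_square power3_eq_cube)
    then show ?thesis
      using curv_pos1 [OF that] by simp
  qed
  have "curv1 i t = 0" if "t \<in> I" "i \<in> {1..<d}" for i t
  proof (cases "i = 1")
    case True
    then show ?thesis using curv1_zero that by simp
  next
    case False
    then have "i = 2" "3 \<le> d" using that d3 by auto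
    then show ?thesis
      using coeff(3) [OF that(1)] curv1_zero [OF that(1)] curv_pos1 [OF that(1)] by simp
  qed
  then have "\<exists>c>0. \<forall>t\<in>I. k i t = c" if i: "i \<in> {1..<d}" for i
  proof -
    obtain c where c: "\<And>t. t \<in> I \<Longrightarrow> curv i t = c"
      using curv_constant \<open>\<And>i t. t \<in> I \<Longrightarrow> i \<in> {1..<d} \<Longrightarrow> curv1 i t = 0\<close> i by metis
    obtain t where t: "t \<in> I"
      using interval(2) interior_subset by blast
    have "c > 0" using curv_pos [OF t, of i] c [OF t] i by simp
    moreover have "\<forall>t\<in>I. k i t = c"
      using c i by (auto simp: curv_def)
    ultimately show ?thesis by blast
  qed
  then show "frenet_helix I \<gamma> d E k"
    using frenet by (simp add: frenet_helix_def)
qed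

lemma helix_imp_biharmonic:
  assumes torsion: "\<And>t. t \<in> I \<Longrightarrow> complex_torsion \<gamma> frame 1 2 t = 0" and d: "2 \<le> d" "d \<le> 3"
    and helix: "frenet_helix I \<gamma> d E k" and curv: "\<And>t. t \<in> I \<Longrightarrow> (curv 1 t)\<^sup>2 + (curv 2 t)\<^sup>2 = 1"
  shows "biharmonic_curve CP I \<gamma>"
  unfolding biharmonic_curve_def
proof
  fix t assume t: "t \<in> I"
  have curv1: "curv1 i s = 0" if "s \<in> I" for i s
  proof -
    obtain c where "\<And>s. s \<in> I \<Longrightarrow> curv i s = c"
    proof (cases "i \<in> {1..<d}")
      case True
      then obtain c where "\<forall>s\<in>I. k i s = c"
        using helix unfolding frenet_helix_def by blast
      with True show ?thesis using that by (auto simp: curv_def)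
    next
      case False
      then show ?thesis using that [of 0] by (auto simp: curv_def)
    qed
    then show ?thesis
      by (rule derivative_zero [OF that curv_has_derivative(1) [OF that]])
  qed
  have "curv2 1 t = 0"
    by (rule derivative_zero [OF t curv_has_derivative(2) [OF t] curv1])
  moreover have "- (curv 1 t ^ 3) - curv 1 t * (curv 2 t)\<^sup>2 + curv 1 t = curv 1 t * (1 - ((curv 1 t)\<^sup>2 + (curv 2 t)\<^sup>2))"
    by (simp add: algebra_simps power2_eq_square power3_eq_cube)
  ultimately show "bitension CP I \<gamma> t = 0"
    using curv [OF t] d(2) by (simp add: bitension_eq [OF t torsion [OF t]] curv1 [OF t] curv_zero)
qed

end

theorem proposition5p5:
  fixes n d :: nat
    and I :: "real set"
    and \<gamma> :: "real \<Rightarrow> complex^'m::finite^'m"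
    and E :: "nat \<Rightarrow> real \<Rightarrow> complex^'m^'m"
    and k :: "nat \<Rightarrow> real \<Rightarrow> real"
  assumes dim: "CARD('m) = n + 1"
    and interval: "is_interval I" "interior I \<noteq> {}"
    and frenet: "frenet_curve I \<gamma> d E k"
    and torsion: "\<And>t. 2 \<le> d \<Longrightarrow> t \<in> I \<Longrightarrow> complex_torsion \<gamma> E 1 2 t = 0"
  shows "proper_biharmonic_curve CP I \<gamma> \<longleftrightarrow>
    (n = 2 \<and> d = 2 \<and> frenet_helix I \<gamma> d E k \<and> (\<forall>t\<in>I. k 1 t = 1)) \<or>
    (n \<ge> 3 \<and>
      ((d = 2 \<and> frenet_helix I \<gamma> d E k \<and> (\<forall>t\<in>I. k 1 t = 1)) \<or>
       (d = 3 \<and> frenet_helix I \<gamma> d E k \<and> (\<forall>t\<in>I. (k 1 t)\<^sup>2 + (k 2 t)\<^sup>2 = 1))))"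
proof -
  interpret frenet_CP I \<gamma> d E k
    by unfold_locales (fact interval frenet)+
  show ?thesis
  proof (cases "2 \<le> d")
    case False
    then have "d = 1" using d_pos by simp
    then show ?thesis
      using harmonic_iff by (simp add: proper_biharmonic_curve_def)
  next
    case d: True
    then have frame_torsion: "complex_torsion \<gamma> frame 1 2 t = 0" if "t \<in> I" for t
      using torsion [OF d that] by (simp add: complex_torsion_def frame_def)
    have K2: "(\<forall>t\<in>I. (curv 1 t)\<^sup>2 + (curv 2 t)\<^sup>2 = 1) \<longleftrightarrow> (\<forall>t\<in>I. k 1 t = 1)" if "d = 2"
    proof -
      have "(curv 1 t)\<^sup>2 + (curv 2 t)\<^sup>2 = 1 \<longleftrightarrow> k 1 t = 1" if "t \<in> I" for t
      proof -
        have "curv 2 t = 0"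
          by (rule curv_zero) (simp add: \<open>d = 2\<close>)
        moreover have "curv 1 t = k 1 t"
          using d by (simp add: curv_def)
        moreover have "curv 1 t > 0"
          using curv_pos [OF that, of 1] d by simp
        ultimately show ?thesis
          by (auto simp: power2_eq_1_iff)
      qed
      then show ?thesis by blast
    qed
    have K3: "(\<forall>t\<in>I. (curv 1 t)\<^sup>2 + (curv 2 t)\<^sup>2 = 1) \<longleftrightarrow> (\<forall>t\<in>I. (k 1 t)\<^sup>2 + (k 2 t)\<^sup>2 = 1)" if "d = 3"
    proof -
      have "curv 1 = k 1" "curv 2 = k 2"
        unfolding curv_def using that by auto
      then show ?thesis by simp
    qed
    have "proper_biharmonic_curve CP I \<gamma> \<longleftrightarrow>
        d \<le> 3 \<and> frenet_helix I \<gamma> d E k \<and> (\<forall>t\<in>I. (curv 1 t)\<^sup>2 + (curv 2 t)\<^sup>2 = 1)"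
    proof
      assume "proper_biharmonic_curve CP I \<gamma>"
      then have "biharmonic_curve CP I \<gamma>"
        by (simp add: proper_biharmonic_curve_def)
      from biharmonic_imp_helix [OF frame_torsion d this]
      show "d \<le> 3 \<and> frenet_helix I \<gamma> d E k \<and> (\<forall>t\<in>I. (curv 1 t)\<^sup>2 + (curv 2 t)\<^sup>2 = 1)"
        by blast
    next
      assume h: "d \<le> 3 \<and> frenet_helix I \<gamma> d E k \<and> (\<forall>t\<in>I. (curv 1 t)\<^sup>2 + (curv 2 t)\<^sup>2 = 1)"
      then have "biharmonic_curve CP I \<gamma>"
        by (intro helix_imp_biharmonic [OF frame_torsion d]) blast+
      moreover have "\<not> harmonic_curve CP I \<gamma>"
        using harmonic_iff d by linarith
      ultimately show "proper_biharmonic_curve CP I \<gamma>"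
        by (simp add: proper_biharmonic_curve_def)
    qed
    note proper = this
    show ?thesis
    proof (cases "d \<le> 3")
      case False
      then have "d \<noteq> 2" "d \<noteq> 3" by auto
      with False proper show ?thesis by blast
    next
      case True
      then have "d \<le> n"
        using dim_bound [OF frame_torsion d] dim by simp
      from d True consider "d = 2" | "d = 3" by linarith
      then show ?thesis
      proof cases
        case 1
        have "n = 2 \<or> n \<ge> 3" using \<open>d \<le> n\<close> d by linarith
        moreover have "d \<noteq> 3" using 1 by simp
        ultimately show ?thesis
          using 1 True unfolding proper K2 [OF 1] by blast
      next
        case 2
        have "n \<ge> 3" "d \<noteq> 2" using \<open>d \<le> n\<close> 2 by linarith+
        with 2 True show ?thesis
          unfolding proper K3 [OF 2] by blast
      qed
    qed
  qed
qed

end
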